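(* Let $\mathcal C$ and $\overline{\mathcal C}$ be two regular perfect curves defined by irreducible polynomials $f,\overline f\in\mathbb R[x,y]$ respectively, neither having $(0:1:0)$ as an infinity point, with $f$ and $\overline f$ normalized so that the coefficient of the highest pure power of $y$ (namely $y^{\deg f}$, resp. $y^{\deg\overline f}$) equals $1$. Then $\mathcal C$ and $\overline{\mathcal C}$ approach each other if and only if $f$ and $\overline f$ have the same degree $d$ and their homogeneous terms of degree $d$ and $d-1$ are the same, i.e. $f_d=\overline f_d$ and $f_{d-1}=\overline f_{d-1}$.
   Context: Curves. A plane curve over $\mathbb C$ is the zero set in $\mathbb C^2$ of an irreducible polynomial $f$ of degree $d\ge 1$. Write $f=f_d+f_{d-1}+\cdots+f_0$ with $f_i$ homogeneous of degree $i$, and $F(x,y,z)=f_d+zf_{d-1}+\cdots+z^df_0$ for the polynomial of its projective closure. The infinity points are the points $(a:b:0)$ with $f_d(a,b)=0$. (If $(0:1:0)$ is not an infinity point, the coefficient of $y^d$ in $f$ is non-zero.) A regular perfect curve is a curve having a unique infinity point, which is regular (a non-singular point of the projective closure). Infinity branches. Let $\mathcal C$ be a curve and $(1:m:0)$, $m\in\mathbb C$, an infinity point. Put $g(y,z)=F(1,y,z)$. Let $\varphi(z)=m+a_1z^{N_1/N}+a_2z^{N_2/N}+\cdots$ (finitely or infinitely many terms, $a_i\ne0$, $N,N_i\in\mathbb N$, $0<N_1<N_2<\cdots$) be a Puiseux series with $g(\varphi(z),z)=0$ and ramification index $N$ (the least common denominator of its exponents). Its conjugates are $\varphi_j(z)=m+a_1c_j^{N_1}z^{N_1/N}+a_2c_j^{N_2}z^{N_2/N}+\cdots$,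 where $c_1,\dots,c_N$ are the $N$-th roots of unity. Put $r_j(z)=z\varphi_j(z^{-1})$, which converges for $|z|>M$ for some $M>0$. The set $B=\bigcup_{j=1}^N L_j$, with leaves $L_j=\{(z,r_j(z))\in\mathbb C^2: |z|>M\}$, is an infinity branch of $\mathcal C$ associated to $(1:m:0)$. Approaching curves. Let $d(p,\overline{\mathcal C})$ be the usual distance in $\mathbb C^2$ from a point $p$ to a curve $\overline{\mathcal C}$. A curve $\overline{\mathcal C}$ approaches $\mathcal C$ at its infinity branch $B$ if there is a leaf $\{(z,r(z)):|z|>M\}\subset B$ with $\lim_{z\to\infty}d((z,r(z)),\overline{\mathcal C})=0$. This relation is symmetric: $\overline{\mathcal C}$ approaches $\mathcal C$ at some infinity branch of $\mathcal C$ if and only if $\mathcal C$ approaches $\overline{\mathcal C}$ at some infinity branch of $\overline{\mathcal C}$; in this case one says that they approach each other. *)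

theory Defs
  imports "HOL-Analysis.Analysis"
begin

text \<open>
  A polynomial in \<open>x\<close>, \<open>y\<close> is an element of \<open>R[x][y]\<close>, a polynomial in \<open>x\<close>, \<open>y\<close>, \<open>z\<close> an element
  of \<open>R[x][y][z]\<close>.  So \<open>coeff (coeff f j) i\<close> is the coefficient of \<open>x^i y^j\<close> in \<open>f\<close>.
\<close>

definition poly2 :: "'a::comm_ring_1 poly poly \<Rightarrow> 'a \<Rightarrow> 'a \<Rightarrow> 'a"
  where "poly2 f x y = poly (poly f [:y:]) x"

definition poly3 :: "'a::comm_ring_1 poly poly poly \<Rightarrow> 'a \<Rightarrow> 'a \<Rightarrow> 'a \<Rightarrow> 'a"
  where "poly3 F x y z = poly (poly (poly F [:[:z:]:]) [:y:]) x"

definition total_degree :: "'a::comm_ring_1 poly poly \<Rightarrow> nat"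
  where "total_degree f = (LEAST d. \<forall>i j. coeff (coeff f j) i \<noteq> 0 \<longrightarrow> i + j \<le> d)"

definition hom_part :: "nat \<Rightarrow> 'a::comm_ring_1 poly poly \<Rightarrow> 'a poly poly"
  where "hom_part k f = (\<Sum>j\<le>k. monom (monom (coeff (coeff f j) (k - j)) (k - j)) j)"

definition homogenization :: "'a::comm_ring_1 poly poly \<Rightarrow> 'a poly poly poly"
  where "homogenization f = (\<Sum>k\<le>total_degree f. monom (hom_part (total_degree f - k) f) k)"

definition complexify :: "real poly poly \<Rightarrow> complex poly poly"
  where "complexify f = map_poly (map_poly complex_of_real) f"


subsection \<open>Plane curves and their infinity points\<close>

text \<open>A curve is given by its defining polynomial.\<close>

definition plane_curve :: "complex poly poly \<Rightarrow> bool"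
  where "plane_curve f \<longleftrightarrow> irreducible f \<and> 1 \<le> total_degree f"

definition curve_points :: "complex poly poly \<Rightarrow> (complex \<times> complex) set"
  where "curve_points f = {(x, y). poly2 f x y = 0}"

text \<open>The point \<open>(a:b:c)\<close> of the projective plane, as the set of its homogeneous coordinates.\<close>

definition proj_point :: "complex \<Rightarrow> complex \<Rightarrow> complex \<Rightarrow> (complex \<times> complex \<times> complex) set"
  where "proj_point a b c = {(t * a, t * b, t * c) | t. t \<noteq> 0}"

definition infinity_points :: "complex poly poly \<Rightarrow> (complex \<times> complex \<times> complex) set set"
  where "infinity_points f =
    {proj_point a b 0 | a b. (a, b) \<noteq> (0, 0) \<and> poly2 (hom_part (total_degree f) f) a b = 0}"

text \<open>The three derivatives are those with respect to \<open>x\<close>, \<open>y\<close> and \<open>z\<close>.\<close>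

definition regular_point :: "complex poly poly \<Rightarrow> (complex \<times> complex \<times> complex) set \<Rightarrow> bool"
  where "regular_point f P \<longleftrightarrow>
    (let F = homogenization f in
      \<forall>(a, b, c)\<in>P. poly3 F a b c = 0 \<and>
        (poly3 (map_poly (map_poly pderiv) F) a b c \<noteq> 0 \<or>
         poly3 (map_poly pderiv F) a b c \<noteq> 0 \<or>
         poly3 (pderiv F) a b c \<noteq> 0))"

definition regular_perfect_curve :: "complex poly poly \<Rightarrow> bool"
  where "regular_perfect_curve f \<longleftrightarrow>
    plane_curve f \<and> (\<exists>P. infinity_points f = {P} \<and> regular_point f P)"


subsection \<open>Infinity branches\<close>

text \<open>
  The Puiseux series \<open>\<phi>(z) = \<psi>(z^(1/N))\<close> is given by \<open>N\<close> and the formal power series \<open>\<psi>\<close>.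
  The exponents of \<open>\<phi>\<close> are the \<open>n / N\<close> with \<open>fps_nth \<psi> n \<noteq> 0\<close>.  With \<open>F\<close> the homogenization of \<open>f\<close>, the
  equation \<open>F(1, \<phi>(z), z) = 0\<close> is stated in \<open>\<complex>[[t]]\<close> where \<open>t = z^(1/N)\<close>.
\<close>

definition ramification_index :: "nat \<Rightarrow> complex fps \<Rightarrow> bool"
  where "ramification_index N \<psi> \<longleftrightarrow> 0 < N \<and>
    N = (LEAST q. 0 < q \<and> (\<forall>n. fps_nth \<psi> n \<noteq> 0 \<longrightarrow> of_nat q * (of_nat n / of_nat N :: rat) \<in> \<int>))"

definition puiseux_root :: "complex poly poly \<Rightarrow> nat \<Rightarrow> complex fps \<Rightarrow> bool"
  where "puiseux_root f N \<psi> \<longleftrightarrow>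
    poly3 (map_poly (map_poly (map_poly fps_const)) (homogenization f)) 1 \<psi> (fps_X ^ N) = 0"

text \<open>
  \<open>r(z) = z \<phi>\<^sub>c(1/z)\<close> for the conjugate \<open>\<phi>\<^sub>c\<close> of \<open>\<phi>\<close> belonging to the \<open>N\<close>-th root of unity \<open>c\<close>.
  The \<open>N\<close>-th root of \<open>1/z\<close> is the principal one; another choice of it permutes, for each \<open>z\<close>, the
  values belonging to the different \<open>c\<close>.
\<close>

definition leaf_fun :: "nat \<Rightarrow> complex fps \<Rightarrow> complex \<Rightarrow> complex \<Rightarrow> complex"
  where "leaf_fun N \<psi> c z = z * eval_fps \<psi> (c * (1 / z) powr (1 / of_nat N))"

definition leaf :: "nat \<Rightarrow> complex fps \<Rightarrow> complex \<Rightarrow> real \<Rightarrow> (complex \<times> complex) set"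
  where "leaf N \<psi> c M = {(z, leaf_fun N \<psi> c z) | z. M < norm z}"

text \<open>
  \<open>B\<close> is the infinity branch over \<open>|z| > M\<close> obtained from \<open>\<psi>\<close>, associated to \<open>(1:m:0)\<close>.  The condition on
  the radius of convergence says that all \<open>r(z)\<close> with \<open>|z| > M\<close> converge.
\<close>

definition branch_data ::
    "complex poly poly \<Rightarrow> complex \<Rightarrow> (complex \<times> complex) set \<Rightarrow> nat \<Rightarrow> complex fps \<Rightarrow> real \<Rightarrow> bool"
  where "branch_data f m B N \<psi> M \<longleftrightarrow>
    proj_point 1 m 0 \<in> infinity_points f \<and> fps_nth \<psi> 0 = m \<and>
    ramification_index N \<psi> \<and> puiseux_root f N \<psi> \<and>
    0 < M \<and> ereal ((1 / M) powr (1 / real N)) \<le> fps_conv_radius \<psi> \<and>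
    B = (\<Union>c\<in>{c. c ^ N = 1}. leaf N \<psi> c M)"

definition infinity_branch ::
    "complex poly poly \<Rightarrow> complex \<Rightarrow> (complex \<times> complex) set \<Rightarrow> bool"
  where "infinity_branch f m B \<longleftrightarrow> (\<exists>N \<psi> M. branch_data f m B N \<psi> M)"


subsection \<open>Approaching curves\<close>

text \<open>
  The curve of \<open>g\<close> approaches the curve of \<open>f\<close> at the branch \<open>B\<close> of the latter.  The metric on
  \<open>complex \<times> complex\<close> is the Euclidean one.  For the empty set \<open>infdist\<close> is \<open>0\<close>, but a plane
  curve is never empty.
\<close>

definition approaches_at ::
    "complex poly poly \<Rightarrow> complex poly poly \<Rightarrow> (complex \<times> complex) set \<Rightarrow> bool"
  where "approaches_at g f B \<longleftrightarrow>
    (\<exists>m N \<psi> M c. branch_data f m B N \<psi> M \<and> c ^ N = 1 \<and>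
      ((\<lambda>z. infdist (z, leaf_fun N \<psi> c z) (curve_points g)) \<longlongrightarrow> 0) at_infinity)"

definition approaches :: "complex poly poly \<Rightarrow> complex poly poly \<Rightarrow> bool"
  where "approaches g f \<longleftrightarrow> (\<exists>m B. infinity_branch f m B \<and> approaches_at g f B)"

definition approach_each_other :: "complex poly poly \<Rightarrow> complex poly poly \<Rightarrow> bool"
  where "approach_each_other f g \<longleftrightarrow> approaches g f \<and> approaches f g"

end

(*
  In the chart x = 1 put u = y/x, z = 1/x and e = u - m. A regular perfect curve of degree d has
  F(1,u,z) = e^d + z f_{d-1}(1,u) + O(z^2), with f_{d-1}(1,m) nonzero if d > 1, so along the curve
  e^d / z tends to -f_{d-1}(1,m): near the infinity point z has the size of e^d.  Two affine points
  at distance o(1) have coordinates u, u' and z, z' with u - u' = o(z) and z - z' = o(z^2).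

  If the curves approach each other, comparing e^d / z gives equal m and equal degrees. Moving from
  a point of the first curve to the nearby point of the second changes the second polynomial by
  o(z e^(d-1)) only, so the difference q of the polynomials f_{d-1}(1,u) satisfies
  q(u) = o(e^(d-1)); having degree below d, it vanishes.

  Conversely, if the two top parts agree, then the second polynomial h is O(z^2) on a branch of the
  first curve, while its derivative in u has the size of e^(d-1). A polynomial p of degree d has a
  root within d |p/p'| of any point, here within O(z^2 / e^(d-1)) = o(z), which is a distance o(1)
  in the affine plane.
*)
theory Submission
  imports Defs "HOL-Complex_Analysis.Complex_Analysis"
    "HOL-Computational_Algebra.Fundamental_Theorem_Algebra"
begin

subsection \<open>Homogeneous parts and the chart at infinity\<close>

lemma pderiv_sum:
  fixes p :: "'b \<Rightarrow> 'a::{comm_semiring_1,semiring_no_zero_divisors} poly"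
  shows "pderiv (\<Sum>j\<in>A. p j) = (\<Sum>j\<in>A. pderiv (p j))"
  by (induction A rule: infinite_finite_induct) (simp_all add: pderiv_add)

lemma smult_sum_right: "smult c (\<Sum>j\<in>A. p j) = (\<Sum>j\<in>A. smult c (p j))"
  by (induction A rule: infinite_finite_induct) (simp_all add: smult_add_right)

text \<open>With \<open>f\<^sub>k\<close> the homogeneous part of degree \<open>k\<close>, \<open>dehom k f\<close> is \<open>f\<^sub>k(1, y)\<close> and \<open>chart f z\<close> is \<open>F(1, y, z)\<close>.\<close>

definition dehom :: "nat \<Rightarrow> 'a::comm_ring_1 poly poly \<Rightarrow> 'a poly"
  where "dehom k f = (\<Sum>j\<le>k. monom (coeff (coeff f j) (k - j)) j)"

definition chart :: "'a::comm_ring_1 poly poly \<Rightarrow> 'a \<Rightarrow> 'a poly"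
  where "chart f z = (\<Sum>k\<le>total_degree f. smult (z ^ k) (dehom (total_degree f - k) f))"

lemma coeff_dehom: "coeff (dehom k f) j = (if j \<le> k then coeff (coeff f j) (k - j) else 0)"
  by (simp add: dehom_def coeff_sum coeff_monom if_distrib cong: if_cong)

lemma degree_dehom_le: "degree (dehom k f) \<le> k"
  by (rule degree_le) (simp add: coeff_dehom)

lemma degree_chart_le: "degree (chart f z) \<le> total_degree f"
  unfolding chart_def
  by (intro degree_sum_le) (auto intro!: order_trans[OF degree_smult_le] order_trans[OF degree_dehom_le])

lemma coeff_hom_part:
  "coeff (coeff (hom_part k f) j) i = (if i + j = k then coeff (coeff f j) i else 0)"
proof -
  have "coeff (coeff (hom_part k f) j) i =
      (\<Sum>j'\<le>k. if j' = j then (if k - j' = i then coeff (coeff f j') (k - j') else 0) else 0)"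
    unfolding hom_part_def coeff_sum by (intro sum.cong refl) (auto simp: coeff_monom)
  then show ?thesis
    by auto
qed

text \<open>\<open>LEAST\<close> is informative only when some bound exists; the largest degree in x
  plus the degree in y is one.\<close>

lemma coeff_eq_0_if_total_degree_less:
  assumes "total_degree f < i + j"
  shows "coeff (coeff f j) i = 0"
proof -
  define d where "d = Max (insert 0 ((\<lambda>j. degree (coeff f j)) ` {..degree f})) + degree f"
  have "\<forall>i j. coeff (coeff f j) i \<noteq> 0 \<longrightarrow> i + j \<le> d"
  proof (intro allI impI)
    fix i j
    assume nz: "coeff (coeff f j) i \<noteq> 0"
    then have "j \<le> degree f"
      by (intro le_degree) auto
    moreover have "i \<le> degree (coeff f j)"
      using nz le_degree by blast
    ultimately have "i \<le> Max (insert 0 ((\<lambda>j. degree (coeff f j)) ` {..degree f}))"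
      by (intro order_trans[OF _ Max_ge]) auto
    with \<open>j \<le> degree f\<close> show "i + j \<le> d"
      by (simp add: d_def)
  qed
  then have "\<forall>i j. coeff (coeff f j) i \<noteq> 0 \<longrightarrow> i + j \<le> total_degree f"
    unfolding total_degree_def by (rule LeastI)
  with assms show ?thesis
    by (meson leD)
qed

lemma sum_hom_part: "(\<Sum>k\<le>total_degree f. hom_part k f) = f"
proof (intro poly_eqI)
  fix i j
  have "coeff (coeff (\<Sum>k\<le>total_degree f. hom_part k f) j) i
      = (if i + j \<le> total_degree f then coeff (coeff f j) i else 0)"
    by (simp add: coeff_sum coeff_hom_part)
  then show "coeff (coeff (\<Sum>k\<le>total_degree f. hom_part k f) j) i = coeff (coeff f j) i"
    by (auto simp: coeff_eq_0_if_total_degree_less)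
qed

lemma poly2_sum: "poly2 (\<Sum>k\<in>A. f k) x y = (\<Sum>k\<in>A. poly2 (f k) x y)"
  by (simp add: poly2_def poly_sum)

lemma poly2_hom_part:
  "poly2 (hom_part k f) x y = (\<Sum>j\<le>k. coeff (coeff f j) (k - j) * x ^ (k - j) * y ^ j)"
  by (simp add: poly2_def hom_part_def poly_sum poly_monom poly_power)

lemma poly_dehom: "poly (dehom k f) y = (\<Sum>j\<le>k. coeff (coeff f j) (k - j) * y ^ j)"
  by (simp add: dehom_def poly_sum poly_monom)

lemma poly2_hom_part_1: "poly2 (hom_part k f) 1 y = poly (dehom k f) y"
  by (simp add: poly2_hom_part poly_dehom)

text \<open>On the line x = 0 only the pure power of y survives, so a non-zero coefficient of
  \<open>y^d\<close> keeps (0:1:0) away from the infinity points.\<close>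

lemma poly2_hom_part_0: "poly2 (hom_part k f) 0 y = coeff (coeff f k) 0 * y ^ k"
proof -
  have "poly2 (hom_part k f) 0 y = (\<Sum>j\<le>k. if j = k then coeff (coeff f k) 0 * y ^ k else 0)"
    unfolding poly2_hom_part by (intro sum.cong) (auto simp: zero_power)
  then show ?thesis
    by simp
qed

text \<open>Setting x = 1 in a form of known degree k loses nothing: the exponent of x is k -
  j.\<close>

lemma hom_part_eq_iff: "hom_part k f = hom_part k g \<longleftrightarrow> dehom k f = dehom k g"
proof
  assume eq: "hom_part k f = hom_part k g"
  show "dehom k f = dehom k g"
  proof (rule poly_eqI)
    fix j
    have "coeff (coeff (hom_part k f) j) (k - j) = coeff (coeff (hom_part k g) j) (k - j)"
      by (simp add: eq)
    then show "coeff (dehom k f) j = coeff (dehom k g) j"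
      by (auto simp: coeff_dehom coeff_hom_part)
  qed
next
  assume eq: "dehom k f = dehom k g"
  show "hom_part k f = hom_part k g"
  proof (intro poly_eqI)
    fix i j
    have "coeff (dehom k f) j = coeff (dehom k g) j"
      by (simp add: eq)
    then show "coeff (coeff (hom_part k f) j) i = coeff (coeff (hom_part k g) j) i"
      by (auto simp: coeff_dehom coeff_hom_part split: if_splits)
  qed
qed

lemma poly2_hom_part_field:
  fixes x :: "'a::field"
  assumes "x \<noteq> 0"
  shows "poly2 (hom_part k f) x y = x ^ k * poly (dehom k f) (y / x)"
  unfolding poly2_hom_part poly_dehom sum_distrib_left
  by (intro sum.cong refl) (use assms in \<open>auto simp: power_divide power_diff field_simps\<close>)

lemma poly2_eq_chart:
  fixes x :: "'a::field"
  assumes "x \<noteq> 0"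
  shows "poly2 f x y = x ^ total_degree f * poly (chart f (1 / x)) (y / x)"
proof -
  let ?d = "total_degree f"
  have "poly2 f x y = (\<Sum>k\<le>?d. poly2 (hom_part k f) x y)"
    by (subst sum_hom_part[symmetric]) (simp only: poly2_sum)
  also have "\<dots> = (\<Sum>k\<le>?d. poly2 (hom_part (?d - k) f) x y)"
    by (rule sum.reindex_bij_witness[of _ "\<lambda>k. ?d - k" "\<lambda>k. ?d - k"]) auto
  also have "\<dots> = (\<Sum>k\<le>?d. x ^ ?d * ((1 / x) ^ k * poly (dehom (?d - k) f) (y / x)))"
    by (intro sum.cong refl) (use assms in \<open>simp add: poly2_hom_part_field power_diff power_divide\<close>)
  finally show ?thesis
    by (simp add: chart_def poly_sum sum_distrib_left)
qed

lemma total_degree_complexify [simp]: "total_degree (complexify f) = total_degree f"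
  by (simp add: total_degree_def complexify_def coeff_map_poly)

lemma coeff_complexify [simp]:
  "coeff (coeff (complexify f) j) i = complex_of_real (coeff (coeff f j) i)"
  by (simp add: complexify_def coeff_map_poly)

lemma hom_part_complexify_eq_iff:
  "hom_part k (complexify f) = hom_part k (complexify g) \<longleftrightarrow> hom_part k f = hom_part k g"
  by (auto simp: poly_eq_iff coeff_hom_part)

lemma coeff_homogenization:
  "coeff (homogenization f) k =
    (if k \<le> total_degree f then hom_part (total_degree f - k) f else 0)"
  by (simp add: homogenization_def coeff_sum coeff_monom if_distrib cong: if_cong)

lemma poly3_eq_poly2_at_0: "poly3 F a b 0 = poly2 (coeff F 0) a b"
  by (simp add: poly3_def poly2_def poly_0_coeff_0)

lemma proj_point_1_eq_iff: "proj_point 1 m 0 = proj_point 1 m' 0 \<longleftrightarrow> m = m'"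
proof
  assume "proj_point 1 m 0 = proj_point 1 m' 0"
  moreover have "(1, m, 0) \<in> proj_point 1 m 0"
    by (auto simp: proj_point_def intro!: exI[of _ 1])
  ultimately show "m = m'"
    by (auto simp: proj_point_def)
qed auto

lemma proj_point_scale:
  assumes "c \<noteq> 0"
  shows "proj_point (c * a) (c * b) (c * e) = proj_point a b e"
proof (intro set_eqI iffI)
  fix p
  assume "p \<in> proj_point a b e"
  then obtain t where "p = (t * a, t * b, t * e)" "t \<noteq> 0"
    by (auto simp: proj_point_def)
  with assms show "p \<in> proj_point (c * a) (c * b) (c * e)"
    by (auto simp: proj_point_def intro!: exI[of _ "t / c"])
next
  fix p
  assume "p \<in> proj_point (c * a) (c * b) (c * e)"
  then obtain t where "p = (t * (c * a), t * (c * b), t * (c * e))" "t \<noteq> 0"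
    by (auto simp: proj_point_def)
  with assms show "p \<in> proj_point a b e"
    by (auto simp: proj_point_def intro!: exI[of _ "t * c"])
qed

section \<open>The infinity point of a regular perfect curve\<close>

lemma monic_poly_eq_power_if_unique_root:
  fixes p :: "'a::alg_closed_field poly"
  assumes "lead_coeff p = 1" "\<And>x. poly p x = 0 \<Longrightarrow> x = m"
  shows "p = [:-m, 1:] ^ degree p"
proof -
  have "p \<noteq> 0"
    using assms(1) by auto
  then obtain A where A: "size A = degree p" "p = smult (lead_coeff p) (\<Prod>x\<in>#A. [:-x, 1:])"
    using alg_closed_imp_factorization by blast
  then have p: "p = (\<Prod>x\<in>#A. [:-x, 1:])"
    using assms(1) by (metis smult_1_left)
  have "x = m" if "x \<in># A" for x
  proof -
    have "[:-x, 1:] dvd p"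
      unfolding p by (intro dvd_prod_mset) (use that in auto)
    then show ?thesis
      using assms(2) poly_eq_0_iff_dvd by blast
  qed
  then have "A = replicate_mset (degree p) m"
    using A(1) set_mset_subset_singletonD[of A m] by auto
  then show ?thesis
    by (subst p) simp
qed

text \<open>
  Besides \<open>f\<^sub>d(1, y) = (y - m)\<^sup>d\<close>, regularity of \<open>(1:m:0)\<close> for \<open>d \<ge> 2\<close> amounts to \<open>f\<^sub>d\<^sub>-\<^sub>1(1, m) \<noteq> 0\<close>: the derivatives of
  \<open>F\<close> with respect to \<open>x\<close> and \<open>y\<close> vanish there.
\<close>

definition perfect_at :: "complex poly poly \<Rightarrow> complex \<Rightarrow> bool"
  where "perfect_at f m \<longleftrightarrow> 1 \<le> total_degree f \<and>
    dehom (total_degree f) f = [:-m, 1:] ^ total_degree f \<and>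
    (2 \<le> total_degree f \<longrightarrow> poly (dehom (total_degree f - 1) f) m \<noteq> 0)"

text \<open>Euler's identity x p_x + y p_y = d p for the form p of degree d, taken at x = 1.\<close>

lemma poly2_pderiv_x_hom_part:
  "poly2 (map_poly pderiv (hom_part d f)) 1 y
    = of_nat d * poly (dehom d f) y - y * poly (pderiv (dehom d f)) y"
proof -
  \<comment> \<open>For j = d the exponent d - j - 1 is cut off at 0, but the factor d - j then
    removes the monomial.\<close>
  have m: "map_poly pderiv (hom_part d f) =
      (\<Sum>j\<le>d. monom (monom (of_nat (d - j) * coeff (coeff f j) (d - j)) (d - j - 1)) j)"
  proof (intro poly_eqI)
    fix i j
    have "coeff (coeff (\<Sum>j\<le>d. monom (monom (of_nat (d - j) * coeff (coeff f j) (d - j)) (d - j - 1)) j) j) i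
        = (\<Sum>j'\<le>d. if j' = j then (if d - j - 1 = i then of_nat (d - j) * coeff (coeff f j) (d - j) else 0) else 0)"
      unfolding coeff_sum by (intro sum.cong refl) auto
    also have "\<dots> = coeff (coeff (map_poly pderiv (hom_part d f)) j) i"
      by (cases "Suc i + j = d") (auto simp: coeff_map_poly coeff_hom_part coeff_pderiv)
    finally show "coeff (coeff (map_poly pderiv (hom_part d f)) j) i =
        coeff (coeff (\<Sum>j\<le>d. monom (monom (of_nat (d - j) * coeff (coeff f j) (d - j)) (d - j - 1)) j) j) i"
      by simp
  qed
  have "y * poly (pderiv (dehom d f)) y = (\<Sum>j\<le>d. of_nat j * coeff (coeff f j) (d - j) * y ^ j)"
    unfolding dehom_def pderiv_sum poly_sum sum_distrib_left
    by (intro sum.cong refl) (auto simp: pderiv_monom poly_monom power_eq_if)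
  moreover have "poly2 (map_poly pderiv (hom_part d f)) 1 y
      = (\<Sum>j\<le>d. of_nat (d - j) * coeff (coeff f j) (d - j) * y ^ j)"
    by (simp add: m poly2_def poly_sum poly_monom poly_power)
  moreover have "of_nat d * poly (dehom d f) y = (\<Sum>j\<le>d. of_nat d * coeff (coeff f j) (d - j) * y ^ j)"
    by (simp add: poly_dehom sum_distrib_left mult.assoc)
  ultimately show ?thesis
    by (simp add: sum_subtractf[symmetric] of_nat_diff algebra_simps)
qed

text \<open>Uniqueness of the infinity point leaves the monic polynomial f_d(1, y) of degree d with
  the single root m, hence equal to (y - m)^d.\<close>

lemma regular_perfect_curve_perfect_at:
  assumes "regular_perfect_curve f" "coeff (coeff f (total_degree f)) 0 = 1"
  obtains m where "perfect_at f m" "infinity_points f = {proj_point 1 m 0}"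
proof -
  define d where "d = total_degree f"
  define F where "F = homogenization f"
  from assms(1) obtain P where P: "plane_curve f" "infinity_points f = {P}" "regular_point f P"
    unfolding regular_perfect_curve_def by blast
  have d: "1 \<le> d"
    using P(1) by (simp add: plane_curve_def d_def)
  from P(2) obtain a b where ab: "P = proj_point a b 0" "(a, b) \<noteq> (0, 0)" "poly2 (hom_part d f) a b = 0"
    unfolding infinity_points_def d_def by blast
  \<comment> \<open>The pure power of y has coefficient 1, so f_d(0, b) = 0 would force b =
    0.\<close>
  have "a \<noteq> 0"
    using ab assms(2) by (auto simp: poly2_hom_part_0 d_def)
  define m where "m = b / a"
  have Pm: "P = proj_point 1 m 0"
    using proj_point_scale[OF \<open>a \<noteq> 0\<close>, of 1 m 0] \<open>a \<noteq> 0\<close> by (simp add: ab m_def)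
  have inf: "proj_point 1 y 0 \<in> infinity_points f" if "poly (dehom d f) y = 0" for y
    using that unfolding infinity_points_def poly2_hom_part_1[symmetric] d_def by fastforce
  have lc: "coeff (dehom d f) d = 1"
    using assms(2) by (simp add: coeff_dehom d_def)
  then have deg: "degree (dehom d f) = d"
    using degree_dehom_le le_degree by (metis le_antisym zero_neq_one)
  have "y = m" if "poly (dehom d f) y = 0" for y
    using inf[OF that] P(2) by (simp add: Pm proj_point_1_eq_iff)
  then have "dehom d f = [:-m, 1:] ^ degree (dehom d f)"
    by (intro monic_poly_eq_power_if_unique_root) (simp_all add: deg lc)
  then have pow: "dehom d f = [:-m, 1:] ^ d"
    unfolding deg .
  have "poly (dehom (d - 1) f) m \<noteq> 0" if "2 \<le> d"
  proof
    assume z: "poly (dehom (d - 1) f) m = 0"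
    \<comment> \<open>As d is at least 2, m is a multiple root. With Euler's identity the
      derivatives in x and y vanish, and the one in z is f_{d-1}(1, m).\<close>
    have root: "poly (dehom d f) m = 0" and root': "poly (pderiv (dehom d f)) m = 0"
      using that by (auto simp: pow poly_power pderiv_power poly_mult)
    have "(1, m, 0) \<in> P"
      by (auto simp: Pm proj_point_def intro!: exI[of _ 1])
    then consider "poly3 (map_poly (map_poly pderiv) F) 1 m 0 \<noteq> 0" |
         "poly3 (map_poly pderiv F) 1 m 0 \<noteq> 0" | "poly3 (pderiv F) 1 m 0 \<noteq> 0"
      using P(3) unfolding regular_point_def Let_def F_def by blast
    then show False
    proof cases
      case 1
      moreover have "coeff (map_poly (map_poly pderiv) F) 0 = map_poly pderiv (hom_part d f)"
        by (simp add: F_def coeff_map_poly coeff_homogenization d_def)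
      ultimately show False
        using d root root' by (simp add: poly3_eq_poly2_at_0 poly2_pderiv_x_hom_part)
    next
      case 2
      have "coeff (map_poly pderiv F) 0 = pderiv (hom_part d f)"
        by (simp add: F_def coeff_map_poly coeff_homogenization d_def)
      moreover have "poly2 (pderiv (hom_part d f)) 1 m = poly (pderiv (dehom d f)) m"
        by (simp add: hom_part_def dehom_def pderiv_sum poly2_def poly_sum poly_monom pderiv_monom
            poly_power)
      ultimately show False
        using 2 root' by (simp add: poly3_eq_poly2_at_0)
    next
      case 3
      have "coeff (pderiv F) 0 = hom_part (d - 1) f"
        using d by (simp add: F_def coeff_pderiv coeff_homogenization d_def)
      then show False
        using 3 z by (simp add: poly3_eq_poly2_at_0 poly2_hom_part_1)
    qed
  qed
  with d pow have "perfect_at f m"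
    by (simp add: perfect_at_def d_def)
  then show thesis
    using that P(2) Pm by blast
qed

subsection \<open>Roots of complex polynomials\<close>

text \<open>Over the complex numbers this is \<open>p'/p = \<Sum> 1 / (y - r)\<close>; splitting off one root at a time avoids the sum.\<close>

lemma norm_pderiv_le_if_roots_far:
  fixes p :: "complex poly"
  assumes "\<And>r. poly p r = 0 \<Longrightarrow> \<delta> \<le> norm (y - r)" "0 \<le> \<delta>"
  shows "\<delta> * norm (poly (pderiv p) y) \<le> real (degree p) * norm (poly p y)"
  using assms(1)
proof (induction "degree p" arbitrary: p)
  case 0
  then obtain c where "p = [:c:]"
    by (metis degree_eq_zeroE)
  then show ?case
    by simp
next
  case (Suc n)
  obtain r where r: "poly p r = 0"
    using Suc.hyps(2) alg_closed_imp_poly_has_root[of p] by auto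
  then obtain q where q: "p = [:-r, 1:] * q"
    by (metis poly_eq_0_iff_dvd dvdE)
  with Suc.hyps(2) have "q \<noteq> 0"
    by auto
  then have "degree p = degree q + 1"
    unfolding q by (subst degree_mult_eq) auto
  with Suc.hyps(2) have deg: "n = degree q" "degree p = n + 1"
    by auto
  have "\<delta> \<le> norm (y - x)" if "poly q x = 0" for x
    using Suc.prems[of x] that by (simp add: q)
  then have IH: "\<delta> * norm (poly (pderiv q) y) \<le> real n * norm (poly q y)"
    using Suc.hyps(1)[OF deg(1)] deg(1) by simp
  have p': "poly (pderiv p) y = poly q y + (y - r) * poly (pderiv q) y"
    unfolding q pderiv_mult by (simp add: pderiv_pCons algebra_simps)
  have "\<delta> * norm (poly (pderiv p) y)
      \<le> \<delta> * (norm (poly q y) + norm (y - r) * norm (poly (pderiv q) y))"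
    unfolding p' norm_mult[symmetric] by (intro mult_left_mono norm_triangle_ineq assms(2))
  also have "\<dots> = \<delta> * norm (poly q y) + norm (y - r) * (\<delta> * norm (poly (pderiv q) y))"
    by (simp add: algebra_simps)
  also have "\<dots> \<le> norm (y - r) * norm (poly q y) + norm (y - r) * (real n * norm (poly q y))"
    by (intro add_mono mult_right_mono mult_left_mono IH Suc.prems r) auto
  also have "\<dots> = real (degree p) * norm (poly p y)"
  proof -
    have "norm (poly p y) = norm (y - r) * norm (poly q y)"
      unfolding q poly_mult norm_mult by simp
    then show ?thesis
      by (simp add: deg(2) algebra_simps)
  qed
  finally show ?case .
qed

text \<open>Let r be a root nearest to y and use its distance from y as \<delta> in
  \<open>norm_pderiv_le_if_roots_far\<close>.\<close>

lemma exists_root_near: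
  fixes p :: "complex poly"
  assumes "poly (pderiv p) y \<noteq> 0"
  obtains r where "poly p r = 0"
    "norm (y - r) \<le> real (degree p) * norm (poly p y) / norm (poly (pderiv p) y)"
proof -
  define R where "R = {r. poly p r = 0}"
  have "pderiv p \<noteq> 0"
    using assms by auto
  then have "p \<noteq> 0" "degree p \<noteq> 0"
    by (auto simp: pderiv_eq_0_iff)
  then have R: "finite R" "R \<noteq> {}"
    using alg_closed_imp_poly_has_root[of p] by (auto simp: R_def poly_roots_finite)
  define r where "r = arg_min_on (\<lambda>r. norm (y - r)) R"
  have r: "r \<in> R" "\<And>s. s \<in> R \<Longrightarrow> norm (y - r) \<le> norm (y - s)"
    unfolding r_def using R by (auto intro: arg_min_if_finite(1) arg_min_least)
  have "norm (y - r) * norm (poly (pderiv p) y) \<le> real (degree p) * norm (poly p y)"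
    by (rule norm_pderiv_le_if_roots_far) (use r(2) R_def in auto)
  then show thesis
    using that[of r] r(1) assms by (simp add: R_def field_simps)
qed

text \<open>A non-zero q has an order k at m that is at most its degree, hence at most n. Then q(u)
  has the size of (u - m)^k, too large to be o((u - m)^n).\<close>

lemma poly_eq_0_if_smallo_power:
  fixes q :: "complex poly"
  assumes u: "(u \<longlongrightarrow> m) F" and "F \<noteq> bot"
    and lim: "((\<lambda>x. poly q (u x) / (u x - m) ^ n) \<longlongrightarrow> 0) F"
    and nz: "\<forall>\<^sub>F x in F. (u x - m) ^ n \<noteq> 0"
    and deg: "degree q \<le> n"
  shows "q = 0"
proof (rule ccontr)
  assume "q \<noteq> 0"
  define k where "k = order m q"
  obtain r where r: "q = [:-m, 1:] ^ k * r" "\<not> [:-m, 1:] dvd r"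
    using order_decomp[OF \<open>q \<noteq> 0\<close>, of m] unfolding k_def by blast
  have "k \<le> n"
    using order_degree[OF \<open>q \<noteq> 0\<close>, of m] deg unfolding k_def by linarith
  have rm: "poly r m \<noteq> 0"
    using r(2) poly_eq_0_iff_dvd by blast
  \<comment> \<open>Multiplying by (u - m)^(n - k) leaves the cofactor r(u), whose limit r(m) is not
    0.\<close>
  have "((\<lambda>x. poly q (u x) / (u x - m) ^ n * (u x - m) ^ (n - k)) \<longlongrightarrow> 0 * (m - m) ^ (n - k)) F"
    by (intro tendsto_intros lim u)
  moreover have "\<forall>\<^sub>F x in F. poly q (u x) / (u x - m) ^ n * (u x - m) ^ (n - k) = poly r (u x)"
    using nz
  proof eventually_elim
    case (elim x)
    have "(u x - m) ^ n = (u x - m) ^ k * (u x - m) ^ (n - k)"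
      using \<open>k \<le> n\<close> by (simp flip: power_add)
    moreover from this elim have "(u x - m) ^ k \<noteq> 0" "(u x - m) ^ (n - k) \<noteq> 0"
      by auto
    moreover have "poly q (u x) = (u x - m) ^ k * poly r (u x)"
      by (simp add: r(1))
    ultimately show ?case
      by auto
  qed
  ultimately have "((\<lambda>x. poly r (u x)) \<longlongrightarrow> 0) F"
    by (simp add: tendsto_cong)
  moreover have "((\<lambda>x. poly r (u x)) \<longlongrightarrow> poly r m) F"
    by (intro tendsto_intros u)
  ultimately show False
    using rm tendsto_unique[OF \<open>F \<noteq> bot\<close>] by blast
qed

subsection \<open>Points close to the infinity point\<close>

text \<open>What F(1, y, z) contains beyond f_d(1, y) + z f_{d-1}(1, y), divided by z^2. Being
  polynomial in y and z it stays bounded along a germ, so its contribution to F is O(z^2).\<close>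

definition chart_tail :: "complex poly poly \<Rightarrow> complex \<Rightarrow> complex poly"
  where "chart_tail f z =
    (\<Sum>k\<in>{2..total_degree f}. smult (z ^ (k - 2)) (dehom (total_degree f - k) f))"

lemma chart_eq_tail:
  assumes "1 \<le> total_degree f"
  shows "chart f z = dehom (total_degree f) f + smult z (dehom (total_degree f - 1) f)
    + smult (z\<^sup>2) (chart_tail f z)"
proof -
  have "{..total_degree f} = insert 0 (insert 1 {2..total_degree f})"
    using assms by auto
  moreover have "(\<Sum>k\<in>{2..total_degree f}. smult (z ^ k) (dehom (total_degree f - k) f))
      = smult (z\<^sup>2) (chart_tail f z)"
  proof -
    have "z ^ k = z\<^sup>2 * z ^ (k - 2)" if "k \<in> {2..total_degree f}" for k
      using that by (metis atLeastAtMost_iff le_add_diff_inverse power_add)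
    then show ?thesis
      unfolding chart_tail_def smult_sum_right smult_smult by (intro sum.cong refl) metis
  qed
  ultimately show ?thesis
    by (simp add: chart_def add.assoc)
qed

lemma poly_chart_perfect_at:
  assumes "perfect_at f m"
  shows "poly (chart f z) u = (u - m) ^ total_degree f
    + z * (poly (dehom (total_degree f - 1) f) u + z * poly (chart_tail f z) u)"
  using assms chart_eq_tail[of f z]
  by (simp add: perfect_at_def algebra_simps power2_eq_square)

lemma tendsto_poly_chart_tail:
  assumes "(u \<longlongrightarrow> m) F" "(z \<longlongrightarrow> 0) F"
  shows "((\<lambda>x. poly (chart_tail f (z x)) (u x)) \<longlongrightarrow> poly (chart_tail f 0) m) F"
  unfolding chart_tail_def poly_sum poly_smult by (intro tendsto_intros assms)

text \<open>Points \<open>(1:u:z)\<close> of the projective closure tending to \<open>(1:m:0)\<close>; the affine point is \<open>(1/z, u/z)\<close>.\<close>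

definition germ :: "complex poly poly \<Rightarrow> complex \<Rightarrow> ('a \<Rightarrow> complex) \<Rightarrow> ('a \<Rightarrow> complex) \<Rightarrow> 'a filter \<Rightarrow> bool"
  where "germ f m u z F \<longleftrightarrow> perfect_at f m \<and> (u \<longlongrightarrow> m) F \<and> (z \<longlongrightarrow> 0) F \<and>
    (\<forall>\<^sub>F x in F. z x \<noteq> 0) \<and> (\<forall>\<^sub>F x in F. poly (chart f (z x)) (u x) = 0)"

text \<open>The equation F(1, u, z) = 0 is solved for (u - m)^d and divided by z.\<close>

lemma germ_power_tendsto:
  assumes "germ f m u z F"
  shows "((\<lambda>x. (u x - m) ^ total_degree f / z x) \<longlongrightarrow> - poly (dehom (total_degree f - 1) f) m) F"
proof -
  have g: "perfect_at f m" "(u \<longlongrightarrow> m) F" "(z \<longlongrightarrow> 0) F" "\<forall>\<^sub>F x in F. z x \<noteq> 0"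
      "\<forall>\<^sub>F x in F. poly (chart f (z x)) (u x) = 0"
    using assms by (auto simp: germ_def)
  have "((\<lambda>x. - (poly (dehom (total_degree f - 1) f) (u x) + z x * poly (chart_tail f (z x)) (u x)))
      \<longlongrightarrow> - (poly (dehom (total_degree f - 1) f) m + 0 * poly (chart_tail f 0) m)) F"
    by (intro tendsto_intros tendsto_poly_chart_tail g)
  moreover have "\<forall>\<^sub>F x in F. - (poly (dehom (total_degree f - 1) f) (u x)
      + z x * poly (chart_tail f (z x)) (u x)) = (u x - m) ^ total_degree f / z x"
    using g(4,5)
  proof eventually_elim
    case (elim x)
    then have "(u x - m) ^ total_degree f = - (poly (dehom (total_degree f - 1) f) (u x)
      + z x * poly (chart_tail f (z x)) (u x)) * z x"
      unfolding poly_chart_perfect_at[OF g(1)] mult_minus_left eq_neg_iff_add_eq_0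
      by (simp add: mult.commute)
    then show ?case
      using elim(1) by simp
  qed
  ultimately show ?thesis
    by (simp add: tendsto_cong)
qed

text \<open>For degree at least 2 regularity makes the limit of (u - m)^d / z non-zero.\<close>

lemma germ_eventually_nonzero:
  assumes "germ f m u z F" "2 \<le> total_degree f"
  shows "\<forall>\<^sub>F x in F. u x - m \<noteq> 0"
proof -
  have "- poly (dehom (total_degree f - 1) f) m \<noteq> 0"
    using assms by (auto simp: germ_def perfect_at_def)
  then have "\<forall>\<^sub>F x in F. (u x - m) ^ total_degree f / z x \<noteq> 0"
    using tendsto_imp_eventually_ne[OF germ_power_tendsto[OF assms(1)]] by blast
  then show ?thesis
    by eventually_elim (use assms(2) in auto)
qed

lemma germ_eventually_power_nonzero:
  assumes "germ f m u z F"
  shows "\<forall>\<^sub>F x in F. (u x - m) ^ (total_degree f - 1) \<noteq> 0"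
proof (cases "2 \<le> total_degree f")
  case True
  from germ_eventually_nonzero[OF assms this] show ?thesis
    by eventually_elim simp
qed simp

text \<open>With e = u - m the quotient is e divided by e^d / z, and for d at least 2 the divisor
  has a non-zero limit while e tends to 0. For d = 1 the quotient is z itself.\<close>

lemma germ_z_smallo:
  assumes "germ f m u z F"
  shows "((\<lambda>x. z x / (u x - m) ^ (total_degree f - 1)) \<longlongrightarrow> 0) F"
proof -
  have g: "perfect_at f m" "(u \<longlongrightarrow> m) F" "(z \<longlongrightarrow> 0) F" "\<forall>\<^sub>F x in F. z x \<noteq> 0"
    using assms by (auto simp: germ_def)
  show ?thesis
  proof (cases "2 \<le> total_degree f")
    case True
    then have "((\<lambda>x. (u x - m) / ((u x - m) ^ total_degree f / z x))
        \<longlongrightarrow> (m - m) / - poly (dehom (total_degree f - 1) f) m) F"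
      using g(1) by (intro tendsto_intros g germ_power_tendsto assms) (auto simp: perfect_at_def)
    moreover have "\<forall>\<^sub>F x in F. (u x - m) / ((u x - m) ^ total_degree f / z x)
        = z x / (u x - m) ^ (total_degree f - 1)"
      using germ_eventually_nonzero[OF assms True]
    proof eventually_elim
      case (elim x)
      have "(u x - m) ^ total_degree f = (u x - m) * (u x - m) ^ (total_degree f - 1)"
        using True by (simp flip: power_Suc)
      with elim show ?case
        by simp
    qed
    ultimately show ?thesis
      by (simp add: tendsto_cong)
  next
    case False
    then have "total_degree f - 1 = 0"
      by auto
    then show ?thesis
      using g(3) by simp
  qed
qed

section \<open>Equality modulo o(z)\<close>

definition close_mod :: "('a \<Rightarrow> complex) \<Rightarrow> 'a filter \<Rightarrow> ('a \<Rightarrow> complex) \<Rightarrow> ('a \<Rightarrow> complex) \<Rightarrow> bool"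
  where "close_mod z F a a' \<longleftrightarrow> (\<exists>l. (a \<longlongrightarrow> l) F) \<and> (\<exists>l. (a' \<longlongrightarrow> l) F) \<and>
    ((\<lambda>x. (a x - a' x) / z x) \<longlongrightarrow> 0) F"

lemma close_mod_const: "close_mod z F (\<lambda>_. c) (\<lambda>_. c)"
  by (auto simp: close_mod_def)

lemma close_mod_add:
  assumes "close_mod z F a a'" "close_mod z F b b'"
  shows "close_mod z F (\<lambda>x. a x + b x) (\<lambda>x. a' x + b' x)"
proof -
  have "((\<lambda>x. (a x - a' x) / z x + (b x - b' x) / z x) \<longlongrightarrow> 0 + 0) F"
    using assms by (intro tendsto_add) (auto simp: close_mod_def)
  then have "((\<lambda>x. (a x + b x - (a' x + b' x)) / z x) \<longlongrightarrow> 0) F"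
    by (simp add: add_divide_distrib diff_divide_distrib algebra_simps)
  then show ?thesis
    using assms by (auto simp: close_mod_def intro: tendsto_add)
qed

text \<open>The products differ by (a - a') b' + a (b - b'); the limits demanded in
  \<open>close_mod\<close> keep the factors b' and a bounded.\<close>

lemma close_mod_mult:
  assumes "close_mod z F a a'" "close_mod z F b b'"
  shows "close_mod z F (\<lambda>x. a x * b x) (\<lambda>x. a' x * b' x)"
proof -
  obtain la lb where l: "(a \<longlongrightarrow> la) F" "(b' \<longlongrightarrow> lb) F"
    using assms by (auto simp: close_mod_def)
  have "((\<lambda>x. (a x - a' x) / z x * b' x + a x * ((b x - b' x) / z x)) \<longlongrightarrow> 0 * lb + la * 0) F"
    using assms by (intro tendsto_intros l) (auto simp: close_mod_def)
  moreover have "(a x - a' x) / z x * b' x + a x * ((b x - b' x) / z x) = (a x * b x - a' x * b' x) / z x" for x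
    by (simp add: diff_divide_distrib algebra_simps)
  ultimately have "((\<lambda>x. (a x * b x - a' x * b' x) / z x) \<longlongrightarrow> 0) F"
    by simp
  then show ?thesis
    using assms by (auto simp: close_mod_def intro: tendsto_mult)
qed

lemma close_mod_power: "close_mod z F a a' \<Longrightarrow> close_mod z F (\<lambda>x. a x ^ n) (\<lambda>x. a' x ^ n)"
  by (induction n) (simp_all add: close_mod_const close_mod_mult)

lemma close_mod_sum:
  "(\<And>i. i \<in> I \<Longrightarrow> close_mod z F (a i) (a' i)) \<Longrightarrow>
    close_mod z F (\<lambda>x. \<Sum>i\<in>I. a i x) (\<lambda>x. \<Sum>i\<in>I. a' i x)"
  by (induction I rule: infinite_finite_induct) (simp_all add: close_mod_const close_mod_add)

lemma close_mod_poly: "close_mod z F a a' \<Longrightarrow> close_mod z F (\<lambda>x. poly p (a x)) (\<lambda>x. poly p (a' x))"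
  by (induction p) (simp_all add: close_mod_const close_mod_add close_mod_mult)

section \<open>Comparison of two germs\<close>

text \<open>
  With \<open>e = u - m\<close>, the smallest term \<open>e\<^sup>k\<close>, \<open>k < d\<close>, of a polynomial of degree below \<open>d\<close> is \<open>e\<^sup>d\<^sup>-\<^sup>1\<close>. So an error
  \<open>o(z e\<^sup>d\<^sup>-\<^sup>1)\<close> in \<open>F(1, u, z)\<close> still determines all of \<open>f\<^sub>d\<^sub>-\<^sub>1\<close>.
\<close>

lemma germ_chart_diff_smallo:
  assumes f: "germ f m u z F" and g: "perfect_at g m" "total_degree g = total_degree f"
    and u': "(u' \<longlongrightarrow> m) F" "((\<lambda>x. (u x - u' x) / z x) \<longlongrightarrow> 0) F"
    and z': "(z' \<longlongrightarrow> 0) F" "((\<lambda>x. (z x - z' x) / (z x)\<^sup>2) \<longlongrightarrow> 0) F"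
  shows "((\<lambda>x. (poly (chart g (z x)) (u x) - poly (chart g (z' x)) (u' x))
    / (z x * (u x - m) ^ (total_degree f - 1))) \<longlongrightarrow> 0) F"
proof -
  define d where "d = total_degree f"
  define e where "e = (\<lambda>x. u x - m)"
  define e' where "e' = (\<lambda>x. u' x - m)"
  define K where "K = (\<lambda>z u. poly (dehom (d - 1) g) u + z * poly (chart_tail g z) u)"
  have fl: "perfect_at f m" "(u \<longlongrightarrow> m) F" "(z \<longlongrightarrow> 0) F" and znz: "\<forall>\<^sub>F x in F. z x \<noteq> 0"
    using f by (auto simp: germ_def)
  have d: "1 \<le> d"
    using fl(1) by (simp add: perfect_at_def d_def)
  have ze: "((\<lambda>x. z x / e x ^ (d - 1)) \<longlongrightarrow> 0) F"
    using germ_z_smallo[OF f] by (simp add: d_def e_def)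
  have enz: "\<forall>\<^sub>F x in F. e x ^ (d - 1) \<noteq> 0"
    using germ_eventually_power_nonzero[OF f] by (simp add: d_def e_def)
  have ee: "((\<lambda>x. (e x - e' x) / z x) \<longlongrightarrow> 0) F"
    using u'(2) by (simp add: e_def e'_def)
  \<comment> \<open>The difference e^d - e'^d is e - e' times a sum of d products of degree d - 1 in
    e and e'. Once e'/e tends to 1, this sum divided by e^(d-1) has a limit.\<close>
  have T1: "((\<lambda>x. (e x ^ d - e' x ^ d) / (z x * e x ^ (d - 1))) \<longlongrightarrow> 0) F"
  proof (cases "2 \<le> d")
    case True
    have e0: "\<forall>\<^sub>F x in F. e x \<noteq> 0"
      using germ_eventually_nonzero[OF f] True by (simp add: e_def d_def)
    have elim0: "(e \<longlongrightarrow> 0) F"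
      unfolding e_def using fl(2) by (simp add: LIM_zero_iff)
    \<comment> \<open>This expression is e'/e, because (e - e')/e = (e - e')/z * z/e^(d-1) *
      e^(d-2).\<close>
    have "((\<lambda>x. 1 - (e x - e' x) / z x * (z x / e x ^ (d - 1)) * e x ^ (d - 2)) \<longlongrightarrow> 1 - 0 * 0 * 0 ^ (d - 2)) F"
      by (intro tendsto_intros ee ze elim0)
    moreover have "\<forall>\<^sub>F x in F. 1 - (e x - e' x) / z x * (z x / e x ^ (d - 1)) * e x ^ (d - 2) = e' x / e x"
      using e0 znz
    proof eventually_elim
      case (elim x)
      have "e x ^ (d - 1) = e x * e x ^ (d - 2)"
        using True by (simp flip: power_Suc add: numeral_2_eq_2 Suc_diff_Suc)
      with elim show ?case
        by (simp add: field_simps)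
    qed
    ultimately have r: "((\<lambda>x. e' x / e x) \<longlongrightarrow> 1) F"
      by (simp add: tendsto_cong)
    have "((\<lambda>x. (e x - e' x) / z x * (\<Sum>i<d. (e' x / e x) ^ (d - Suc i))) \<longlongrightarrow> 0 * (\<Sum>i<d. 1 ^ (d - Suc i))) F"
      by (intro tendsto_intros ee r)
    moreover have "\<forall>\<^sub>F x in F. (e x - e' x) / z x * (\<Sum>i<d. (e' x / e x) ^ (d - Suc i))
        = (e x ^ d - e' x ^ d) / (z x * e x ^ (d - 1))"
      using e0
    proof eventually_elim
      case (elim x)
      have "(\<Sum>i<d. (e' x / e x) ^ (d - Suc i)) = (\<Sum>i<d. e' x ^ (d - Suc i) * e x ^ i) / e x ^ (d - 1)"
        unfolding sum_divide_distrib
      proof (intro sum.cong refl)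
        fix i
        assume "i \<in> {..<d}"
        then have "e x ^ (d - 1) = e x ^ (d - Suc i) * e x ^ i"
          by (simp flip: power_add)
        with elim show "(e' x / e x) ^ (d - Suc i) = e' x ^ (d - Suc i) * e x ^ i / e x ^ (d - 1)"
          by (simp add: power_divide)
      qed
      then show ?case
        by (simp add: power_diff_sumr2)
    qed
    ultimately show ?thesis
      by (simp add: tendsto_cong)
  next
    case False
    with d have "d = 1"
      by simp
    with ee show ?thesis
      by simp
  qed
  have zz: "((\<lambda>x. (z x - z' x) / z x) \<longlongrightarrow> 0) F"
  proof -
    have "((\<lambda>x. (z x - z' x) / (z x)\<^sup>2 * z x) \<longlongrightarrow> 0 * 0) F"
      by (intro tendsto_mult z' fl)
    moreover have "\<forall>\<^sub>F x in F. (z x - z' x) / (z x)\<^sup>2 * z x = (z x - z' x) / z x"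
      using znz by eventually_elim (simp add: power2_eq_square)
    ultimately have "((\<lambda>x. (z x - z' x) / z x) \<longlongrightarrow> 0 * 0) F"
      by (rule Lim_transform_eventually)
    then show ?thesis
      by simp
  qed
  have cu: "close_mod z F u u'" and cz: "close_mod z F z z'"
    unfolding close_mod_def using u' z' fl zz by blast+
  have cK: "close_mod z F (\<lambda>x. K (z x) (u x)) (\<lambda>x. K (z' x) (u' x))"
    unfolding K_def chart_tail_def poly_sum poly_smult
    by (intro close_mod_add close_mod_mult close_mod_sum close_mod_power close_mod_poly cu cz)
  then obtain l where l: "((\<lambda>x. K (z' x) (u' x)) \<longlongrightarrow> l) F"
    by (auto simp: close_mod_def)
  \<comment> \<open>Writing the chart of g as (u - m)^d + z K(z, u), its change is (z - z') K(z',
    u') + z (K(z, u) - K(z', u')) + e^d - e'^d. The three summands are these terms over z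
    e^(d-1).\<close>
  have "((\<lambda>x. (z x - z' x) / (z x)\<^sup>2 * (z x / e x ^ (d - 1)) * K (z' x) (u' x)
      + (K (z x) (u x) - K (z' x) (u' x)) / z x * (z x / e x ^ (d - 1))
      + (e x ^ d - e' x ^ d) / (z x * e x ^ (d - 1))) \<longlongrightarrow> 0 * 0 * l + 0 * 0 + 0) F"
    using cK by (intro tendsto_intros z' ze T1 l) (auto simp: close_mod_def)
  moreover have "\<forall>\<^sub>F x in F. (z x - z' x) / (z x)\<^sup>2 * (z x / e x ^ (d - 1)) * K (z' x) (u' x)
      + (K (z x) (u x) - K (z' x) (u' x)) / z x * (z x / e x ^ (d - 1))
      + (e x ^ d - e' x ^ d) / (z x * e x ^ (d - 1))
      = (poly (chart g (z x)) (u x) - poly (chart g (z' x)) (u' x)) / (z x * e x ^ (d - 1))"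
    using znz enz
  proof eventually_elim
    case (elim x)
    have c: "poly (chart g z) u = (u - m) ^ d + z * K z u" for z u
      unfolding K_def using poly_chart_perfect_at[OF g(1)] g(2) by (simp add: d_def)
    have 1: "(z x - z' x) / (z x)\<^sup>2 * (z x / e x ^ (d - 1)) * K (z' x) (u' x)
        = (z x - z' x) * K (z' x) (u' x) / (z x * e x ^ (d - 1))"
      using elim by (simp add: power2_eq_square)
    have 2: "(K (z x) (u x) - K (z' x) (u' x)) / z x * (z x / e x ^ (d - 1))
        = z x * (K (z x) (u x) - K (z' x) (u' x)) / (z x * e x ^ (d - 1))"
      using elim by simp
    show ?case
      unfolding 1 2 add_divide_distrib[symmetric]
      by (rule arg_cong[of _ _ "\<lambda>n. n / _"]) (simp add: c e_def e'_def algebra_simps)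
  qed
  ultimately show ?thesis
    by (simp add: tendsto_cong d_def e_def)
qed

text \<open>If d = deg g exceeded c = deg f, then e'^d / z' would behave like e'^(d-c) e^c / z and
  tend to 0, whereas regularity of g at infinity gives it a non-zero limit.\<close>

lemma germ_degree_not_less:
  assumes f: "germ f m u z F" and g: "germ g m u' z' F" and F: "F \<noteq> bot"
    and u': "((\<lambda>x. (u x - u' x) / z x) \<longlongrightarrow> 0) F"
    and z': "((\<lambda>x. z' x / z x) \<longlongrightarrow> 1) F"
  shows "\<not> total_degree f < total_degree g"
proof
  define c where "c = total_degree f"
  define d where "d = total_degree g"
  define e where "e = (\<lambda>x. u x - m)"
  define e' where "e' = (\<lambda>x. u' x - m)"
  assume "total_degree f < total_degree g"
  then have cd: "c < d" "2 \<le> d"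
    using f by (auto simp: germ_def perfect_at_def c_def d_def)
  have znz: "\<forall>\<^sub>F x in F. z x \<noteq> 0" "\<forall>\<^sub>F x in F. z' x \<noteq> 0"
    using f g by (auto simp: germ_def)
  have e0: "\<forall>\<^sub>F x in F. e' x \<noteq> 0"
    using germ_eventually_nonzero[OF g] cd by (simp add: e'_def d_def)
  have elim0: "(e' \<longlongrightarrow> 0) F"
    unfolding e'_def using g by (simp add: LIM_zero_iff germ_def)
  have ze: "((\<lambda>x. z' x / e' x ^ (d - 1)) \<longlongrightarrow> 0) F"
    using germ_z_smallo[OF g] by (simp add: d_def e'_def)
  have ee: "((\<lambda>x. (e x - e' x) / z x) \<longlongrightarrow> 0) F"
    using u' by (simp add: e_def e'_def)
  \<comment> \<open>This expression is e/e'; its convergence to 1 rests on z' = o(e'^(d-1)), which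
    holds along the germ of g.\<close>
  have "((\<lambda>x. 1 + (e x - e' x) / z x / (z' x / z x) * (z' x / e' x ^ (d - 1)) * e' x ^ (d - 2))
      \<longlongrightarrow> 1 + 0 / 1 * 0 * 0 ^ (d - 2)) F"
    by (intro tendsto_intros ee ze elim0 z') auto
  moreover have "\<forall>\<^sub>F x in F. 1 + (e x - e' x) / z x / (z' x / z x) * (z' x / e' x ^ (d - 1)) * e' x ^ (d - 2)
      = e x / e' x"
    using e0 znz
  proof eventually_elim
    case (elim x)
    have "e' x ^ (d - 1) = e' x * e' x ^ (d - 2)"
      using cd by (simp flip: power_Suc add: numeral_2_eq_2 Suc_diff_Suc)
    with elim show ?case
      by (simp add: field_simps)
  qed
  ultimately have r: "((\<lambda>x. e x / e' x) \<longlongrightarrow> 1) F"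
    by (simp add: tendsto_cong)
  have "((\<lambda>x. e' x ^ (d - c) * (e x ^ c / z x) / (e x / e' x) ^ c / (z' x / z x))
      \<longlongrightarrow> 0 ^ (d - c) * - poly (dehom (c - 1) f) m / 1 ^ c / 1) F"
    using germ_power_tendsto[OF f] by (intro tendsto_intros elim0 r z') (auto simp: c_def e_def)
  moreover have "\<forall>\<^sub>F x in F. e' x ^ (d - c) * (e x ^ c / z x) / (e x / e' x) ^ c / (z' x / z x)
      = e' x ^ d / z' x"
    using e0 znz tendsto_imp_eventually_ne[OF r one_neq_zero]
  proof eventually_elim
    case (elim x)
    have "e' x ^ d = e' x ^ (d - c) * e' x ^ c"
      using cd by (simp flip: power_add)
    with elim show ?case
      by (simp add: power_divide)
  qed
  ultimately have "((\<lambda>x. e' x ^ d / z' x) \<longlongrightarrow> 0 ^ (d - c) * - poly (dehom (c - 1) f) m / 1 ^ c / 1) F"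
    by (rule Lim_transform_eventually)
  then have "((\<lambda>x. e' x ^ d / z' x) \<longlongrightarrow> 0) F"
    using cd by (simp add: zero_power)
  moreover have "((\<lambda>x. e' x ^ d / z' x) \<longlongrightarrow> - poly (dehom (d - 1) g) m) F"
    using germ_power_tendsto[OF g] by (simp add: e'_def d_def)
  ultimately have "- poly (dehom (d - 1) g) m = 0"
    using tendsto_unique[OF F] by blast
  moreover have "poly (dehom (d - 1) g) m \<noteq> 0"
    using g cd by (simp add: germ_def perfect_at_def d_def)
  ultimately show False
    by simp
qed

text \<open>Hypotheses \<open>uu\<close> and \<open>zz\<close> express that the affine points (1/z,
  u/z) and (1/z', u'/z') have distance o(1).\<close>

lemma close_germs_imp_eq_dehom:
  assumes f: "germ f m u z F" and g: "germ g m' u' z' F" and F: "F \<noteq> bot"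
    and uu: "((\<lambda>x. (u x - u' x) / z x) \<longlongrightarrow> 0) F"
    and zz: "((\<lambda>x. (z x - z' x) / (z x)\<^sup>2) \<longlongrightarrow> 0) F"
  shows "total_degree g = total_degree f"
    "dehom (total_degree f) g = dehom (total_degree f) f"
    "dehom (total_degree f - 1) g = dehom (total_degree f - 1) f"
proof -
  define d where "d = total_degree f"
  have fl: "perfect_at f m" "(u \<longlongrightarrow> m) F" "(z \<longlongrightarrow> 0) F" and znz: "\<forall>\<^sub>F x in F. z x \<noteq> 0"
    using f by (auto simp: germ_def)
  have gl: "perfect_at g m'" "(u' \<longlongrightarrow> m') F" "(z' \<longlongrightarrow> 0) F" and znz': "\<forall>\<^sub>F x in F. z' x \<noteq> 0"
    using g by (auto simp: germ_def)
  have "((\<lambda>x. u x - (u x - u' x) / z x * z x) \<longlongrightarrow> m - 0 * 0) F"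
    by (intro tendsto_intros uu fl)
  moreover have "\<forall>\<^sub>F x in F. u x - (u x - u' x) / z x * z x = u' x"
    using znz by eventually_elim simp
  ultimately have "(u' \<longlongrightarrow> m) F"
    by (simp add: tendsto_cong)
  then have m: "m' = m"
    using tendsto_unique[OF F gl(2)] by blast
  have "((\<lambda>x. 1 - (z x - z' x) / (z x)\<^sup>2 * z x) \<longlongrightarrow> 1 - 0 * 0) F"
    by (intro tendsto_intros zz fl)
  moreover have "\<forall>\<^sub>F x in F. 1 - (z x - z' x) / (z x)\<^sup>2 * z x = z' x / z x"
    using znz by eventually_elim (simp add: power2_eq_square field_simps)
  ultimately have z1: "((\<lambda>x. z' x / z x) \<longlongrightarrow> 1) F"
    by (simp add: tendsto_cong)
  \<comment> \<open>Closeness is rewritten relative to z', so that the degrees can also be compared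
    with the two germs exchanged.\<close>
  have z2: "((\<lambda>x. z x / z' x) \<longlongrightarrow> 1) F"
    using tendsto_inverse[OF z1] by (simp add: field_simps)
  have uu': "((\<lambda>x. (u' x - u x) / z' x) \<longlongrightarrow> 0) F"
  proof -
    have "((\<lambda>x. - ((u x - u' x) / z x / (z' x / z x))) \<longlongrightarrow> - (0 / 1)) F"
      by (intro tendsto_intros uu z1) auto
    moreover have "\<forall>\<^sub>F x in F. - ((u x - u' x) / z x / (z' x / z x)) = (u' x - u x) / z' x"
      using znz znz' by eventually_elim (simp add: field_simps)
    ultimately show ?thesis
      by (simp add: tendsto_cong)
  qed
  show deg: "total_degree g = total_degree f"
    using germ_degree_not_less[OF f _ F uu z1] germ_degree_not_less[OF _ f F uu' z2] g
    unfolding m by (meson linorder_neqE_nat)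
  show "dehom (total_degree f) g = dehom (total_degree f) f"
    using fl(1) gl(1) deg m by (simp add: perfect_at_def)
  define q where "q = dehom (d - 1) g - dehom (d - 1) f"
  \<comment> \<open>As both curve equations hold, the first numerator equals z q(u) plus z^2 times
    the difference of the tails at (u, z). Removing the tail term leaves q(u) / (u -
    m)^(d-1).\<close>
  have "((\<lambda>x. (poly (chart g (z x)) (u x) - poly (chart g (z' x)) (u' x)) / (z x * (u x - m) ^ (d - 1))
      - z x / (u x - m) ^ (d - 1) * (poly (chart_tail g (z x)) (u x) - poly (chart_tail f (z x)) (u x)))
      \<longlongrightarrow> 0 - 0 * (poly (chart_tail g 0) m - poly (chart_tail f 0) m)) F"
    unfolding d_def using gl m
    by (intro tendsto_diff[of _ 0] tendsto_mult tendsto_diff tendsto_poly_chart_tail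
        germ_chart_diff_smallo germ_z_smallo f fl uu zz deg) auto
  moreover have "\<forall>\<^sub>F x in F. (poly (chart g (z x)) (u x) - poly (chart g (z' x)) (u' x)) / (z x * (u x - m) ^ (d - 1))
      - z x / (u x - m) ^ (d - 1) * (poly (chart_tail g (z x)) (u x) - poly (chart_tail f (z x)) (u x))
      = poly q (u x) / (u x - m) ^ (d - 1)"
  proof -
    have "\<forall>\<^sub>F x in F. poly (chart f (z x)) (u x) = 0" "\<forall>\<^sub>F x in F. poly (chart g (z' x)) (u' x) = 0"
      using f g by (auto simp: germ_def)
    then show ?thesis
      using znz germ_eventually_power_nonzero[OF f]
    proof eventually_elim
      case (elim x)
      have "poly (chart g (z x)) (u x) - poly (chart g (z' x)) (u' x)
          = poly (chart g (z x)) (u x) - poly (chart f (z x)) (u x)"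
        by (simp add: elim)
      also have "\<dots> = z x * poly q (u x) + z x * z x * (poly (chart_tail g (z x)) (u x) - poly (chart_tail f (z x)) (u x))"
        using poly_chart_perfect_at[OF fl(1)] poly_chart_perfect_at[OF gl(1)] deg m
        by (simp add: q_def d_def algebra_simps)
      finally have "(poly (chart g (z x)) (u x) - poly (chart g (z' x)) (u' x)) / (z x * (u x - m) ^ (d - 1))
          = poly q (u x) / (u x - m) ^ (d - 1)
            + z x / (u x - m) ^ (d - 1) * (poly (chart_tail g (z x)) (u x) - poly (chart_tail f (z x)) (u x))"
        using elim(3) by (simp add: add_divide_distrib mult.assoc)
      then show ?case
        by simp
    qed
  qed
  ultimately have "((\<lambda>x. poly q (u x) / (u x - m) ^ (d - 1)) \<longlongrightarrow> 0) F"
    by (simp add: tendsto_cong)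
  moreover have "degree q \<le> d - 1"
    unfolding q_def by (intro degree_diff_le degree_dehom_le)
  ultimately have "q = 0"
    using germ_eventually_power_nonzero[OF f] fl F
    by (intro poly_eq_0_if_smallo_power[of u m F q "d - 1"]) (auto simp: d_def)
  then show "dehom (total_degree f - 1) g = dehom (total_degree f - 1) f"
    by (simp add: q_def d_def)
qed

text \<open>At u the polynomial \<open>chart g z\<close> has the value z^2 T and the derivative (u -
  m)^(d-1) D, where T stays bounded and D tends to d. Then \<open>exists_root_near\<close> gives a
  root within |z| b.\<close>

lemma exists_close_root_of_eq_dehom:
  assumes f: "germ f m u z F" and g: "perfect_at g m" "total_degree g = total_degree f"
    and eq: "dehom (total_degree f - 1) g = dehom (total_degree f - 1) f"
  obtains b where "(b \<longlongrightarrow> 0) F"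
    "\<forall>\<^sub>F x in F. \<exists>r. poly (chart g (z x)) r = 0 \<and> norm (u x - r) \<le> norm (z x) * b x"
proof -
  define d where "d = total_degree f"
  define P where "P = pderiv (dehom (d - 1) g)"
  define D where "D = (\<lambda>x. of_nat d + z x / (u x - m) ^ (d - 1) *
      (poly P (u x) + z x * poly (pderiv (chart_tail g (z x))) (u x)))"
  define T where "T = (\<lambda>x. poly (chart_tail g (z x)) (u x) - poly (chart_tail f (z x)) (u x))"
  define b where "b = (\<lambda>x. real d * norm (z x / (u x - m) ^ (d - 1)) * norm (T x) / norm (D x))"
  have fl: "perfect_at f m" "(u \<longlongrightarrow> m) F" "(z \<longlongrightarrow> 0) F" and znz: "\<forall>\<^sub>F x in F. z x \<noteq> 0"
    and root: "\<forall>\<^sub>F x in F. poly (chart f (z x)) (u x) = 0"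
    using f by (auto simp: germ_def)
  have d: "1 \<le> d"
    using fl(1) by (simp add: perfect_at_def d_def)
  have ze: "((\<lambda>x. z x / (u x - m) ^ (d - 1)) \<longlongrightarrow> 0) F"
    using germ_z_smallo[OF f] by (simp add: d_def)
  have "((\<lambda>x. poly (pderiv (chart_tail g (z x))) (u x)) \<longlongrightarrow> poly (pderiv (chart_tail g 0)) m) F"
    unfolding chart_tail_def pderiv_sum pderiv_smult poly_sum poly_smult
    by (intro tendsto_intros fl)
  then have "(D \<longlongrightarrow> of_nat d + 0 * (poly P m + 0 * poly (pderiv (chart_tail g 0)) m)) F"
    unfolding D_def by (intro tendsto_intros ze fl)
  then have D: "(D \<longlongrightarrow> of_nat d) F"
    by simp
  have "(T \<longlongrightarrow> poly (chart_tail g 0) m - poly (chart_tail f 0) m) F"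
    unfolding T_def by (intro tendsto_diff tendsto_poly_chart_tail fl)
  then have "(b \<longlongrightarrow> real d * norm (0 :: complex) * norm (poly (chart_tail g 0) m - poly (chart_tail f 0) m)
      / norm (of_nat d :: complex)) F"
    unfolding b_def using d by (intro tendsto_intros ze D) auto
  then have "(b \<longlongrightarrow> 0) F"
    by simp
  moreover have "\<forall>\<^sub>F x in F. D x \<noteq> 0"
    using tendsto_imp_eventually_ne[OF D] d by simp
  with root znz germ_eventually_power_nonzero[OF f]
  have "\<forall>\<^sub>F x in F. \<exists>r. poly (chart g (z x)) r = 0 \<and> norm (u x - r) \<le> norm (z x) * b x"
  proof eventually_elim
    case (elim x)
    have nz: "(u x - m) ^ (d - 1) \<noteq> 0"
      using elim by (simp add: d_def)
    have "poly (pderiv (chart g (z x))) (u x) = of_nat d * (u x - m) ^ (d - 1)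
        + z x * (poly P (u x) + z x * poly (pderiv (chart_tail g (z x))) (u x))"
    proof -
      have "dehom d g = [:-m, 1:] ^ d"
        using g by (simp add: perfect_at_def d_def)
      then have "chart g (z x) = [:-m, 1:] ^ d + smult (z x) (dehom (d - 1) g) + smult ((z x)\<^sup>2) (chart_tail g (z x))"
        using chart_eq_tail[of g "z x"] d g(2) by (simp add: d_def)
      then show ?thesis
        by (simp add: P_def pderiv_add pderiv_smult pderiv_power pderiv_pCons
            power2_eq_square algebra_simps)
    qed
    also have "\<dots> = (u x - m) ^ (d - 1) * D x"
      using nz by (simp add: D_def field_simps)
    finally have p': "poly (pderiv (chart g (z x))) (u x) = (u x - m) ^ (d - 1) * D x" .
    have p: "poly (chart g (z x)) (u x) = z x * z x * T x"
    proof -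
      have "poly (chart g (z x)) (u x) = poly (chart g (z x)) (u x) - poly (chart f (z x)) (u x)"
        by (simp add: elim)
      also have "\<dots> = z x * z x * T x"
        using poly_chart_perfect_at[OF fl(1)] poly_chart_perfect_at[OF g(1)] g(2) eq
        by (simp add: T_def algebra_simps)
      finally show ?thesis .
    qed
    obtain r where r: "poly (chart g (z x)) r = 0"
      "norm (u x - r) \<le> real (degree (chart g (z x))) * norm (poly (chart g (z x)) (u x))
        / norm (poly (pderiv (chart g (z x))) (u x))"
      by (rule exists_root_near[of "chart g (z x)" "u x"]) (use p' nz elim in auto)
    note r(2)
    also have "real (degree (chart g (z x))) * norm (poly (chart g (z x)) (u x))
          / norm (poly (pderiv (chart g (z x))) (u x))
        \<le> real d * norm (poly (chart g (z x)) (u x)) / norm (poly (pderiv (chart g (z x))) (u x))"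
      using degree_chart_le[of g "z x"] g(2)
      by (intro divide_right_mono mult_right_mono) (auto simp: d_def)
    also have "\<dots> = norm (z x) * b x"
      unfolding p p' b_def by (simp add: norm_mult norm_divide)
    finally show ?case
      using r(1) by blast
  qed
  ultimately show thesis
    using that by blast
qed

subsection \<open>Puiseux series and leaves\<close>

lemma poly3_homogenization: "poly3 (homogenization f) 1 y z = poly (chart f z) y"
proof -
  have "poly3 (homogenization f) 1 y z
      = (\<Sum>k\<le>total_degree f. poly2 (hom_part (total_degree f - k) f) 1 y * z ^ k)"
    by (simp add: poly3_def poly2_def homogenization_def poly_sum poly_monom poly_power)
  then show ?thesis
    by (simp add: poly2_hom_part_1 chart_def poly_sum mult.commute)
qed

text \<open>The equation of a Puiseux root has coefficients in the ring of power series. This lemma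
  and the next two move the embedding of constants through homogenization, so that
  \<open>chart\<close> can be used over that ring.\<close>

lemma total_degree_fps_const: "total_degree (map_poly (map_poly fps_const) f) = total_degree f"
  by (simp add: total_degree_def coeff_map_poly)

lemma hom_part_fps_const:
  "hom_part k (map_poly (map_poly fps_const) f) = map_poly (map_poly fps_const) (hom_part k f)"
  by (intro poly_eqI) (simp add: coeff_hom_part coeff_map_poly)

lemma homogenization_fps_const:
  "homogenization (map_poly (map_poly fps_const) f)
    = map_poly (map_poly (map_poly fps_const)) (homogenization f)"
  by (rule poly_eqI) (simp add: coeff_homogenization coeff_map_poly total_degree_fps_const
      hom_part_fps_const)

lemma puiseux_root_iff:
  "puiseux_root f N \<psi> \<longleftrightarrow> poly (chart (map_poly (map_poly fps_const) f) (fps_X ^ N)) \<psi> = 0"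
  by (simp add: puiseux_root_def poly3_homogenization flip: homogenization_fps_const)

text \<open>Substituting into the formal series S gives the analytic left-hand side, and a power
  series with positive radius is determined by its values near 0.\<close>

lemma puiseux_root_iff_eventually:
  assumes "0 < fps_conv_radius \<psi>"
  shows "puiseux_root f N \<psi> \<longleftrightarrow> (\<forall>\<^sub>F t in nhds 0. poly (chart f (t ^ N)) (eval_fps \<psi> t) = 0)"
proof -
  define S where "S = poly (chart (map_poly (map_poly fps_const) f) (fps_X ^ N)) \<psi>"
  have "(\<lambda>t. poly (chart f (t ^ N)) (eval_fps \<psi> t)) has_fps_expansion S"
    unfolding S_def chart_def poly_sum poly_smult poly_dehom total_degree_fps_const
    using assms
    by (auto simp: coeff_map_poly intro!: fps_expansion_intros has_fps_expansion_power
        eval_fps_has_fps_expansion)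
  then have S: "0 < fps_conv_radius S"
      "\<forall>\<^sub>F t in nhds 0. eval_fps S t = poly (chart f (t ^ N)) (eval_fps \<psi> t)"
    by (auto simp: has_fps_expansion_def)
  have "S = 0 \<longleftrightarrow> (\<forall>\<^sub>F t in nhds 0. poly (chart f (t ^ N)) (eval_fps \<psi> t) = 0)"
  proof
    assume "S = 0"
    from S(2) show "\<forall>\<^sub>F t in nhds 0. poly (chart f (t ^ N)) (eval_fps \<psi> t) = 0"
      by eventually_elim (metis \<open>S = 0\<close> eval_fps_0)
  next
    assume "\<forall>\<^sub>F t in nhds 0. poly (chart f (t ^ N)) (eval_fps \<psi> t) = 0"
    with S(2) have "\<forall>\<^sub>F t in nhds 0. eval_fps S t = eval_fps 0 t"
      by eventually_elim simp
    then show "S = 0"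
      by (intro eval_fps_eqD S(1)) auto
  qed
  then show ?thesis
    by (simp add: puiseux_root_iff S_def)
qed

text \<open>The value t = c (1/z)^(1/N) satisfies t^N = 1/z. Inserting it into the analytic form of
  the Puiseux equation puts the leaf on the curve near infinity, for every conjugate c.\<close>

lemma branch_data_germ:
  assumes f: "perfect_at f m" "infinity_points f = {proj_point 1 m 0}"
    and B: "branch_data f m' B N \<psi> M" and c: "c ^ N = 1"
  shows "germ f m (\<lambda>z. leaf_fun N \<psi> c z / z) (\<lambda>z. 1 / z) at_infinity"
proof -
  define t where "t = (\<lambda>z. c * (1 / z) powr (1 / of_nat N))"
  have "proj_point 1 m' 0 = proj_point 1 m 0"
    using B f(2) by (auto simp: branch_data_def)
  then have m: "fps_nth \<psi> 0 = m"
    using B by (simp add: branch_data_def proj_point_1_eq_iff)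
  have N: "0 < N"
    using B by (simp add: branch_data_def ramification_index_def)
  have "0 < (1 / M) powr (1 / real N)"
    using B by (simp add: branch_data_def)
  then have rad: "0 < fps_conv_radius \<psi>"
    using B by (metis branch_data_def ereal_less(2) less_le_trans)
  have tN: "t z ^ N = 1 / z" if "z \<noteq> 0" for z
  proof -
    have "((1 / z) powr (1 / of_nat N)) ^ N = exp (of_nat N * (1 / of_nat N * ln (1 / z)))"
      using that by (simp only: powr_def exp_of_nat_mult) simp
    also have "\<dots> = 1 / z"
      using that N by simp
    finally show ?thesis
      by (simp add: t_def power_mult_distrib c)
  qed
  have inv0: "((\<lambda>z::complex. 1 / z) \<longlongrightarrow> 0) at_infinity"
    unfolding inverse_eq_divide[symmetric] by (rule tendsto_inverse_0)
  \<comment> \<open>The principal root jumps along a ray, so the limit is taken through the modulus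
    |t| = |1/z|^(1/N).\<close>
  have "((\<lambda>z. root N (norm (1 / z :: complex))) \<longlongrightarrow> root N (norm (0 :: complex))) at_infinity"
    by (intro tendsto_intros inv0)
  moreover have "\<forall>\<^sub>F z in at_infinity. root N (norm (1 / z :: complex)) = norm (t z)"
    using eventually_not_equal_at_infinity[of 0]
  proof eventually_elim
    case (elim z)
    then have "norm (1 / z) = norm (t z) ^ N"
      by (metis norm_power tN)
    then show ?case
      using N by (simp add: real_root_power_cancel)
  qed
  ultimately have "((\<lambda>z. norm (t z)) \<longlongrightarrow> 0) at_infinity"
    by (simp add: tendsto_cong)
  then have t: "(t \<longlongrightarrow> 0) at_infinity"
    by (rule tendsto_norm_zero_cancel)
  have leaf: "\<forall>\<^sub>F z in at_infinity. eval_fps \<psi> (t z) = leaf_fun N \<psi> c z / z"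
    using eventually_not_equal_at_infinity[of 0]
    by eventually_elim (simp add: leaf_fun_def t_def)
  have "isCont (eval_fps \<psi>) 0"
    using rad by (intro continuous_eval_fps) (auto simp: zero_ereal_def)
  then have "((\<lambda>z. eval_fps \<psi> (t z)) \<longlongrightarrow> m) at_infinity"
    using isCont_tendsto_compose[OF _ t, of "eval_fps \<psi>"] m by (simp add: eval_fps_at_0)
  then have lim: "((\<lambda>z. leaf_fun N \<psi> c z / z) \<longlongrightarrow> m) at_infinity"
    using leaf by (rule Lim_transform_eventually)
  have "\<forall>\<^sub>F t in nhds 0. poly (chart f (t ^ N)) (eval_fps \<psi> t) = 0"
    using B puiseux_root_iff_eventually[OF rad] by (simp add: branch_data_def)
  then have "\<forall>\<^sub>F z in at_infinity. poly (chart f (t z ^ N)) (eval_fps \<psi> (t z)) = 0"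
    by (rule eventually_compose_filterlim[OF _ t])
  then have "\<forall>\<^sub>F z in at_infinity. poly (chart f (1 / z)) (leaf_fun N \<psi> c z / z) = 0"
    using leaf eventually_not_equal_at_infinity[of 0]
    by eventually_elim (simp add: tN)
  moreover have "\<forall>\<^sub>F z in at_infinity. 1 / z \<noteq> (0 :: complex)"
    using eventually_not_equal_at_infinity[of 0] by eventually_elim simp
  ultimately show ?thesis
    unfolding germ_def using f(1) lim inv0 by blast
qed

subsection \<open>Existence of a branch\<close>

text \<open>Apply the real inverse function theorem to \<open>(v, t) \<mapsto> (G(v, t), t)\<close>; the derivative of \<open>v\<close> is complex linear.\<close>

lemma holomorphic_implicit_function:
  fixes G :: "complex \<times> complex \<Rightarrow> complex"
  assumes G: "\<And>p. (G has_derivative (\<lambda>h. A p * fst h + B p * snd h)) (at p)"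
    and A: "continuous_on UNIV A" and B: "continuous_on UNIV B"
    and G0: "G (v0, 0) = 0" and A0: "A (v0, 0) \<noteq> 0"
  obtains r v where "0 < r" "v holomorphic_on ball 0 r" "v 0 = v0"
    "\<And>t. t \<in> ball 0 r \<Longrightarrow> G (v t, t) = 0"
proof -
  define f where "f = (\<lambda>p. (G p, snd p))"
  define f' where "f' = (\<lambda>p. Blinfun (\<lambda>h. (A p * fst h + B p * snd h, snd h :: complex)))"
  have bl: "bounded_linear (\<lambda>h. (a * fst h + b * snd h, snd h :: complex))" for a b :: complex
    by (intro bounded_linear_Pair bounded_linear_add bounded_linear_const_mult bounded_linear_fst bounded_linear_snd)
  have f'_apply: "blinfun_apply (f' p) = (\<lambda>h. (A p * fst h + B p * snd h, snd h))" for p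
    unfolding f'_def by (rule bounded_linear_Blinfun_apply[OF bl])
  \<comment> \<open>J inverts the triangular derivative with rows (A, B) and (0, 1) at (v0,
    0).\<close>
  define J where "J = Blinfun (\<lambda>h. (1 / A (v0, 0) * fst h + (- B (v0, 0) / A (v0, 0)) * snd h, snd h :: complex))"
  have J_apply: "blinfun_apply J =
      (\<lambda>h. (1 / A (v0, 0) * fst h + (- B (v0, 0) / A (v0, 0)) * snd h, snd h))"
    unfolding J_def by (rule bounded_linear_Blinfun_apply[OF bl])
  have der: "(f has_derivative blinfun_apply (f' p)) (at p)" for p
    unfolding f_def f'_apply by (auto intro!: derivative_eq_intros G)
  have cont: "continuous_on UNIV f'"
    by (intro continuous_on_blinfun_componentwise)
      (auto simp: f'_apply intro!: continuous_intros A B)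
  have inv: "J o\<^sub>L f' (v0, 0) = id_blinfun"
    by (intro blinfun_eqI) (use A0 in \<open>auto simp: f'_apply J_apply field_simps\<close>)
  obtain U V g g' where UV: "open V" "f (v0, 0) \<in> V" "(v0, 0) \<in> U" "homeomorphism U V f g"
    and g: "\<And>y. y \<in> V \<Longrightarrow> (g has_derivative (g' y)) (at y)"
    and g': "\<And>y. y \<in> V \<Longrightarrow> g' y = Hilbert_Choice.inv (blinfun_apply (f' (g y)))"
    and bij: "\<And>y. y \<in> V \<Longrightarrow> bij (blinfun_apply (f' (g y)))"
    by (rule inverse_function_theorem[OF open_UNIV der cont UNIV_I inv]) blast
  have fv0: "f (v0, 0) = (0, 0)"
    by (simp add: f_def G0)
  have fg: "f (g y) = y" if "y \<in> V" for y
    using UV(4) that by (simp add: homeomorphism_def)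
  have "open ((\<lambda>t. (0, t)) -` V)"
    by (intro open_vimage UV(1) continuous_intros)
  moreover have "0 \<in> (\<lambda>t. (0, t)) -` V"
    using UV(2) fv0 by simp
  ultimately obtain r where r: "0 < r" "ball 0 r \<subseteq> (\<lambda>t. (0, t)) -` V"
    by (meson open_contains_ball)
  define v where "v = (\<lambda>t. fst (g (0, t)))"
  have V: "(0, t) \<in> V" if "t \<in> ball 0 r" for t
    using r(2) that by auto
  have gv: "g (0, t) = (v t, t)" "G (v t, t) = 0" if "t \<in> ball 0 r" for t
  proof -
    have "G (g (0, t)) = 0" "snd (g (0, t)) = t"
      using fg[OF V[OF that]] by (auto simp: f_def)
    then show "g (0, t) = (v t, t)" "G (v t, t) = 0"
      by (metis prod.collapse v_def)+
  qed
  have "v field_differentiable at t" if t: "t \<in> ball 0 r" for t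
  proof -
    let ?L = "g' (0, t)" and ?M = "blinfun_apply (f' (g (0, t)))"
    let ?a = "A (v t, t)" and ?b = "B (v t, t)"
    have L: "?L (?M h) = h" for h
      using g'[OF V[OF t]] bij[OF V[OF t]] by (simp add: bij_is_inj)
    \<comment> \<open>Away from t = 0 the coefficient A is non-zero because the derivative remains
      bijective on V.\<close>
    have a: "?a \<noteq> 0"
    proof
      assume "?a = 0"
      then have "?M (1, 0) = ?M (0, 0)"
        by (simp add: f'_apply gv[OF t])
      then show False
        using bij[OF V[OF t]] by (metis bij_is_inj injD prod.inject zero_neq_one)
    qed
    \<comment> \<open>Hence the inverse derivative sends (0, k) to (-b k / a, k), and v has the
      complex derivative -b / a.\<close>
    have "?M (- ?b / ?a * k, k) = (0, k)" for k
      using a by (simp add: f'_apply gv[OF t])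
    then have Lk: "?L (0, k) = (- ?b / ?a * k, k)" for k
      using L by metis
    have "((\<lambda>t. fst (g (0, t))) has_derivative (\<lambda>k. fst (?L (0, k)))) (at t)"
      by (intro has_derivative_fst has_derivative_compose[of "\<lambda>t. (0, t)" "\<lambda>k. (0, k)" t UNIV g ?L]
          g V t) (auto intro!: derivative_eq_intros)
    then have "(v has_derivative (*) (- ?b / ?a)) (at t)"
      unfolding v_def Lk fst_conv .
    then show ?thesis
      by (metis has_field_derivative_def field_differentiable_def)
  qed
  then have "v holomorphic_on ball 0 r"
    by (simp add: holomorphic_on_def field_differentiable_at_within)
  moreover have "v 0 = v0"
  proof -
    have "g (f (v0, 0)) = (v0, 0)"
      using UV(3,4) by (simp add: homeomorphism_def)
    then show ?thesis
      by (simp add: v_def fv0)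
  qed
  ultimately show thesis
    using that r(1) gv(2) by blast
qed

section \<open>Complex C1 functions of two variables\<close>

definition C1_pair :: "(complex \<times> complex \<Rightarrow> complex) \<Rightarrow> bool"
  where "C1_pair G \<longleftrightarrow> (\<exists>A B. (\<forall>p. (G has_derivative (\<lambda>h. A p * fst h + B p * snd h)) (at p)) \<and>
    continuous_on UNIV A \<and> continuous_on UNIV B)"

lemma C1_pairI:
  assumes "\<And>p. (G has_derivative (\<lambda>h. A p * fst h + B p * snd h)) (at p)"
    "continuous_on UNIV A" "continuous_on UNIV B"
  shows "C1_pair G"
  using assms unfolding C1_pair_def by blast

lemma C1_pair_const: "C1_pair (\<lambda>_. c)"
  by (rule C1_pairI[where A = "\<lambda>_. 0" and B = "\<lambda>_. 0"]) auto

lemma C1_pair_fst: "C1_pair fst"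
  by (rule C1_pairI[where A = "\<lambda>_. 1" and B = "\<lambda>_. 0"]) (auto intro!: derivative_eq_intros)

lemma C1_pair_snd: "C1_pair snd"
  by (rule C1_pairI[where A = "\<lambda>_. 0" and B = "\<lambda>_. 1"]) (auto intro!: derivative_eq_intros)

lemma C1_pair_add:
  assumes "C1_pair G" "C1_pair H"
  shows "C1_pair (\<lambda>p. G p + H p)"
proof -
  obtain A B A' B' where
    d: "\<And>p. (G has_derivative (\<lambda>h. A p * fst h + B p * snd h)) (at p)"
      "\<And>p. (H has_derivative (\<lambda>h. A' p * fst h + B' p * snd h)) (at p)"
    and c: "continuous_on UNIV A" "continuous_on UNIV B" "continuous_on UNIV A'" "continuous_on UNIV B'"
    using assms unfolding C1_pair_def by blast
  show ?thesis
    by (rule C1_pairI[where A = "\<lambda>p. A p + A' p" and B = "\<lambda>p. B p + B' p"])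
      (auto intro!: derivative_eq_intros d continuous_intros c simp: algebra_simps)
qed

lemma C1_pair_mult:
  assumes "C1_pair G" "C1_pair H"
  shows "C1_pair (\<lambda>p. G p * H p)"
proof -
  obtain A B A' B' where
    d: "\<And>p. (G has_derivative (\<lambda>h. A p * fst h + B p * snd h)) (at p)"
      "\<And>p. (H has_derivative (\<lambda>h. A' p * fst h + B' p * snd h)) (at p)"
    and c: "continuous_on UNIV A" "continuous_on UNIV B" "continuous_on UNIV A'" "continuous_on UNIV B'"
    using assms unfolding C1_pair_def by blast
  have GH: "continuous_on UNIV G" "continuous_on UNIV H"
    using d by (meson has_derivative_continuous continuous_at_imp_continuous_on)+
  show ?thesis
    by (rule C1_pairI[where A = "\<lambda>p. G p * A' p + A p * H p" and B = "\<lambda>p. G p * B' p + B p * H p"])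
      (auto intro!: derivative_eq_intros d continuous_intros c GH simp: algebra_simps)
qed

lemma C1_pair_power: "C1_pair G \<Longrightarrow> C1_pair (\<lambda>p. G p ^ n)"
  by (induction n) (simp_all add: C1_pair_const C1_pair_mult)

lemma C1_pair_sum: "(\<And>i. i \<in> I \<Longrightarrow> C1_pair (G i)) \<Longrightarrow> C1_pair (\<lambda>p. \<Sum>i\<in>I. G i p)"
  by (induction I rule: infinite_finite_induct) (simp_all add: C1_pair_const C1_pair_add)

lemma C1_pair_poly: "C1_pair G \<Longrightarrow> C1_pair (\<lambda>p. poly q (G p))"
  by (induction q) (simp_all add: C1_pair_const C1_pair_add C1_pair_mult)

text \<open>The closure rules for \<open>C1_pair\<close> settle differentiability of a concrete
  polynomial without writing out its partial derivatives. Only the one in v at (v0, 0) is computed;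
  by uniqueness of derivatives it is A(v0, 0).\<close>

lemma C1_pair_implicit_function:
  assumes "C1_pair G" and G0: "G (v0, 0) = 0"
    and der: "((\<lambda>v. G (v, 0)) has_field_derivative D) (at v0)" and "D \<noteq> 0"
  obtains r v where "0 < r" "v holomorphic_on ball 0 r" "v 0 = v0"
    "\<And>t. t \<in> ball 0 r \<Longrightarrow> G (v t, t) = 0"
proof -
  obtain A B where AB: "\<And>p. (G has_derivative (\<lambda>h. A p * fst h + B p * snd h)) (at p)"
    "continuous_on UNIV A" "continuous_on UNIV B"
    using assms(1) unfolding C1_pair_def by blast
  have "((\<lambda>v. G (v, 0)) has_derivative (\<lambda>h. A (v0, 0) * fst (h, 0 :: complex) + B (v0, 0) * snd (h, 0))) (at v0)"
    by (rule has_derivative_compose[of "\<lambda>v. (v, 0)" "\<lambda>h. (h, 0)" v0 UNIV G])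
      (auto intro!: derivative_eq_intros AB(1))
  then have "((\<lambda>v. G (v, 0)) has_field_derivative A (v0, 0)) (at v0)"
    by (simp add: has_field_derivative_def)
  then have "A (v0, 0) \<noteq> 0"
    using DERIV_unique[OF der] \<open>D \<noteq> 0\<close> by auto
  from holomorphic_implicit_function[OF AB G0 this] that show thesis
    by blast
qed

text \<open>For N at least 2 the exponent 1/N occurs, so every common denominator q of the exponents
  is a multiple of N.\<close>

lemma ramification_indexI:
  assumes "0 < N" "2 \<le> N \<Longrightarrow> fps_nth \<psi> 1 \<noteq> 0"
  shows "ramification_index N \<psi>"
proof -
  have "(LEAST q. 0 < q \<and> (\<forall>n. fps_nth \<psi> n \<noteq> 0 \<longrightarrow> of_nat q * (of_nat n / of_nat N :: rat) \<in> \<int>)) = N"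
  proof (rule Least_equality)
    show "0 < N \<and> (\<forall>n. fps_nth \<psi> n \<noteq> 0 \<longrightarrow> of_nat N * (of_nat n / of_nat N :: rat) \<in> \<int>)"
      using assms(1) by simp
  next
    fix q
    assume q: "0 < q \<and> (\<forall>n. fps_nth \<psi> n \<noteq> 0 \<longrightarrow> of_nat q * (of_nat n / of_nat N :: rat) \<in> \<int>)"
    show "N \<le> q"
    proof (cases "2 \<le> N")
      case True
      then have "of_nat q * (of_nat 1 / of_nat N :: rat) \<in> \<int>"
        using q assms(2) by blast
      then obtain i where i: "of_nat q / of_nat N = (of_int i :: rat)"
        by (auto elim: Ints_cases)
      then have "(of_nat q :: rat) = of_int (i * int N)"
        using assms(1) by (simp add: field_simps)
      then have "int q = i * int N"
        by (metis of_int_eq_iff of_int_of_nat_eq)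
      moreover from this have "0 < i"
        using q assms(1) by (metis of_nat_0_less_iff zero_less_mult_pos2)
      ultimately have "int N \<le> int q"
        using mult_right_mono[of 1 i "int N"] by simp
      then show ?thesis
        by simp
    qed (use q in auto)
  qed
  with assms(1) show ?thesis
    by (simp add: ramification_index_def)
qed

text \<open>
  The substitution \<open>y = m + t v\<close>, \<open>z = t\<^sup>d\<close> turns \<open>F(1, y, z)\<close> into \<open>t\<^sup>d G(v, t)\<close>, and a \<open>d\<close>-th root of \<open>- f\<^sub>d\<^sub>-\<^sub>1(1, m)\<close> is a
  simple zero of \<open>G(\<cdot>, 0)\<close>.
\<close>

lemma exists_infinity_branch:
  assumes f: "perfect_at f m" and inf: "proj_point 1 m 0 \<in> infinity_points f"
  obtains B N \<psi> M where "branch_data f m B N \<psi> M"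
proof -
  define d where "d = total_degree f"
  have d: "1 \<le> d"
    using f by (simp add: perfect_at_def d_def)
  define a where "a = poly (dehom (d - 1) f) m"
  obtain v0 where v0: "v0 ^ d = - a"
    using nth_root_exists[of d "- a"] d by auto
  define G where "G = (\<lambda>p. fst p ^ d + (poly (dehom (d - 1) f) (m + snd p * fst p)
      + snd p ^ d * poly (chart_tail f (snd p ^ d)) (m + snd p * fst p)))"
  have "C1_pair G"
    unfolding G_def chart_tail_def poly_sum poly_smult
    by (intro C1_pair_add C1_pair_mult C1_pair_power C1_pair_sum C1_pair_poly C1_pair_const
        C1_pair_fst C1_pair_snd)
  moreover have G_0: "G (v, 0) = v ^ d + a" for v
    using d by (simp add: G_def a_def zero_power)
  moreover have "((\<lambda>v. G (v, 0)) has_field_derivative of_nat d * v0 ^ (d - 1)) (at v0)"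
    unfolding G_0 by (auto intro!: derivative_eq_intros)
  \<comment> \<open>For d = 1 the root v0 may be 0, but then d v0^(d-1) = 1. For larger d this fact
    also yields the ramification index, since v0 is the coefficient of t in
    \<open>\<psi>\<close>.\<close>
  moreover have nz: "v0 \<noteq> 0" if "2 \<le> d"
    using that v0 f d by (auto simp: perfect_at_def d_def a_def zero_power)
  then have "of_nat d * v0 ^ (d - 1) \<noteq> 0"
    using d by (cases "2 \<le> d") auto
  ultimately obtain r v where r: "0 < r" and v: "v holomorphic_on ball 0 r" "v 0 = v0"
    and Gv: "\<And>t. t \<in> ball 0 r \<Longrightarrow> G (v t, t) = 0"
    using v0 by (elim C1_pair_implicit_function) (auto simp: G_0)
  define w where "w = (\<lambda>t. m + t * v t)"
  define \<psi> where "\<psi> = fps_expansion w 0"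
  \<comment> \<open>Under t^d = 1/z the disc |t| < r corresponds to |z| > M.\<close>
  define M where "M = (1 / r) ^ d"
  have w: "w holomorphic_on eball 0 (ereal r)"
    unfolding w_def using v(1) by (auto intro!: holomorphic_intros)
  have rad: "ereal r \<le> fps_conv_radius \<psi>"
    unfolding \<psi>_def using w by (rule conv_radius_fps_expansion)
  then have rad0: "0 < fps_conv_radius \<psi>"
    using r by (metis ereal_less(2) less_le_trans)
  have eval: "eval_fps \<psi> t = w t" if "t \<in> ball 0 r" for t
    unfolding \<psi>_def using eval_fps_expansion'[OF w, of t] that by simp
  have "poly (chart f (t ^ d)) (eval_fps \<psi> t) = 0" if t: "t \<in> ball 0 r" for t
  proof -
    have "poly (chart f (t ^ d)) (eval_fps \<psi> t) = t ^ d * G (v t, t)"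
      unfolding eval[OF t] poly_chart_perfect_at[OF f]
      by (simp add: w_def G_def d_def power_mult_distrib algebra_simps)
    then show ?thesis
      by (simp add: Gv[OF t])
  qed
  moreover have "\<forall>\<^sub>F t in nhds 0. t \<in> ball (0 :: complex) r"
    using r by (intro eventually_nhds_in_open) auto
  ultimately have "\<forall>\<^sub>F t in nhds 0. poly (chart f (t ^ d)) (eval_fps \<psi> t) = 0"
    by (auto elim: eventually_mono)
  then have pr: "puiseux_root f d \<psi>"
    by (simp add: puiseux_root_iff_eventually[OF rad0])
  have psi0: "fps_nth \<psi> 0 = m"
    using eval[of 0] r by (simp add: eval_fps_at_0 w_def)
  have "(v has_field_derivative deriv v 0) (at 0)"
    using v(1) r by (intro holomorphic_derivI[of v "ball 0 r"]) auto
  then have "(w has_field_derivative v0) (at 0)"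
    unfolding w_def by (auto intro!: derivative_eq_intros simp: v(2))
  then have psi1: "fps_nth \<psi> 1 = v0"
    by (simp add: \<psi>_def fps_expansion_def DERIV_imp_deriv)
  have "M = (1 / r) powr real d"
    using r by (simp add: M_def powr_realpow)
  then have "(1 / M) powr (1 / real d) = r"
    using r d by (simp add: powr_divide powr_powr)
  moreover have "0 < M"
    using r by (simp add: M_def)
  ultimately have "branch_data f m (\<Union>c\<in>{c. c ^ d = 1}. leaf d \<psi> c M) d \<psi> M"
    using d rad pr psi0 psi1 nz inf unfolding branch_data_def
    by (auto intro: ramification_indexI)
  then show thesis
    using that by blast
qed

subsection \<open>Approaching curves\<close>

lemma chart_root_in_curve_points:
  assumes "x \<noteq> 0"
  shows "(x, y) \<in> curve_points f \<longleftrightarrow> poly (chart f (1 / x)) (y / x) = 0"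
  using assms by (simp add: curve_points_def poly2_eq_chart)

lemma infdist_lessE:
  assumes "infdist x A < e" "A \<noteq> {}"
  obtains a where "a \<in> A" "dist x a < e"
proof -
  have "bdd_below (dist x ` A)"
    by (intro bdd_belowI[of _ 0]) auto
  then show thesis
    using assms that by (auto simp: infdist_notempty cINF_less_iff)
qed

text \<open>The leaf of f is one germ. The other consists of nearly nearest points on the curve of
  g, chosen separately for each z, which is why a germ is a pair of arbitrary functions along a
  filter.\<close>

lemma approaches_imp_eq_dehom:
  assumes f: "perfect_at f mf" "infinity_points f = {proj_point 1 mf 0}"
    and g: "perfect_at g mg" "infinity_points g = {proj_point 1 mg 0}"
    and "approaches g f"
  shows "total_degree g = total_degree f"
    "dehom (total_degree f) g = dehom (total_degree f) f"
    "dehom (total_degree f - 1) g = dehom (total_degree f - 1) f"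
proof -
  obtain m B N \<psi> M c where B: "branch_data f m B N \<psi> M" "c ^ N = 1"
    and "((\<lambda>z. infdist (z, leaf_fun N \<psi> c z) (curve_points g)) \<longlongrightarrow> 0) at_infinity"
    using assms(5) by (auto simp: approaches_def approaches_at_def)
  define Y where "Y = leaf_fun N \<psi> c"
  have lim: "((\<lambda>z. infdist (z, Y z) (curve_points g)) \<longlongrightarrow> 0) at_infinity"
    unfolding Y_def by fact
  have gf: "germ f mf (\<lambda>z. Y z / z) (\<lambda>z. 1 / z) at_infinity"
    unfolding Y_def by (rule branch_data_germ[OF f B])
  have nz: "\<forall>\<^sub>F z in at_infinity. z \<noteq> (0 :: complex)"
    by (rule eventually_not_equal_at_infinity)
  \<comment> \<open>The distance to an empty set would be 0 by convention; a branch of g supplies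
    points.\<close>
  have ne: "curve_points g \<noteq> {}"
  proof -
    obtain B' N' \<psi>' M' where B': "branch_data g mg B' N' \<psi>' M'"
      using exists_infinity_branch[OF g(1)] g(2) by blast
    then have "\<forall>\<^sub>F z in at_infinity. poly (chart g (1 / z)) (leaf_fun N' \<psi>' 1 z / z) = 0"
      using branch_data_germ[OF g B', of 1] by (simp add: germ_def)
    with nz have "\<forall>\<^sub>F z in at_infinity. (z, leaf_fun N' \<psi>' 1 z) \<in> curve_points g"
      by eventually_elim (simp add: chart_root_in_curve_points)
    then show ?thesis
      using eventually_happens'[OF trivial_limit_at_infinity] by blast
  qed
  \<comment> \<open>The slack 1/|z| stands in for attainment of the infimum and disappears in the
    limit.\<close>
  have "\<exists>p. z \<noteq> 0 \<longrightarrow> p \<in> curve_points g \<and>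
      dist (z, Y z) p < infdist (z, Y z) (curve_points g) + norm (1 / z)" for z
  proof (cases "z = 0")
    case False
    then have "infdist (z, Y z) (curve_points g) < infdist (z, Y z) (curve_points g) + norm (1 / z)"
      by simp
    then show ?thesis
      using ne by (metis infdist_lessE)
  qed auto
  then obtain p where p: "\<And>z. z \<noteq> 0 \<Longrightarrow> p z \<in> curve_points g"
    "\<And>z. z \<noteq> 0 \<Longrightarrow> dist (z, Y z) (p z) < infdist (z, Y z) (curve_points g) + norm (1 / z)"
    by metis
  define X' where "X' = (\<lambda>z. fst (p z))"
  define Y' where "Y' = (\<lambda>z. snd (p z))"
  have inv0: "((\<lambda>z::complex. 1 / z) \<longlongrightarrow> 0) at_infinity"
    using gf by (simp add: germ_def)
  have "((\<lambda>z. infdist (z, Y z) (curve_points g) + norm (1 / z)) \<longlongrightarrow> 0 + norm (0 :: complex)) at_infinity"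
    by (intro tendsto_intros lim inv0)
  moreover have "\<forall>\<^sub>F z in at_infinity. norm (dist (z, Y z) (p z)) \<le> infdist (z, Y z) (curve_points g) + norm (1 / z)"
    using nz by eventually_elim (use p(2) in \<open>simp add: less_imp_le\<close>)
  ultimately have dist: "((\<lambda>z. dist (z, Y z) (p z)) \<longlongrightarrow> 0) at_infinity"
    by (intro Lim_null_comparison[of "\<lambda>z. dist (z, Y z) (p z)"]) simp_all
  have "norm (X' z - z) \<le> dist (z, Y z) (p z)" for z
    using dist_fst_le[of "(z, Y z)" "p z"] by (simp add: X'_def dist_norm norm_minus_commute)
  then have X: "((\<lambda>z. X' z - z) \<longlongrightarrow> 0) at_infinity"
    by (intro Lim_null_comparison[OF _ dist]) simp
  have "norm (Y' z - Y z) \<le> dist (z, Y z) (p z)" for z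
    using dist_snd_le[of "(z, Y z)" "p z"] by (simp add: Y'_def dist_norm norm_minus_commute)
  then have Y: "((\<lambda>z. Y' z - Y z) \<longlongrightarrow> 0) at_infinity"
    by (intro Lim_null_comparison[OF _ dist]) simp
  have "((\<lambda>z. 1 + (X' z - z) * (1 / z)) \<longlongrightarrow> 1 + 0 * 0) at_infinity"
    by (intro tendsto_intros X inv0)
  moreover have "\<forall>\<^sub>F z in at_infinity. 1 + (X' z - z) * (1 / z) = X' z / z"
    using nz by eventually_elim (simp add: field_simps)
  ultimately have Xz: "((\<lambda>z. X' z / z) \<longlongrightarrow> 1) at_infinity"
    by (simp add: tendsto_cong)
  then have "\<forall>\<^sub>F z in at_infinity. X' z / z \<noteq> 0"
    by (rule tendsto_imp_eventually_ne) simp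
  then have Xnz: "\<forall>\<^sub>F z in at_infinity. X' z \<noteq> 0"
    by eventually_elim auto
  have "((\<lambda>z. (Y z / z + (Y' z - Y z) * (1 / z)) / (X' z / z)) \<longlongrightarrow> (mf + 0 * 0) / 1) at_infinity"
    using gf by (intro tendsto_intros Xz Y inv0) (auto simp: germ_def)
  moreover have "\<forall>\<^sub>F z in at_infinity. (Y z / z + (Y' z - Y z) * (1 / z)) / (X' z / z) = Y' z / X' z"
    using nz Xnz by eventually_elim (simp add: field_simps)
  ultimately have "((\<lambda>z. Y' z / X' z) \<longlongrightarrow> (mf + 0 * 0) / 1) at_infinity"
    by (rule Lim_transform_eventually)
  then have u': "((\<lambda>z. Y' z / X' z) \<longlongrightarrow> mf) at_infinity"
    by simp
  have "((\<lambda>z. 1 / z / (X' z / z)) \<longlongrightarrow> 0 / 1) at_infinity"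
    by (intro tendsto_intros Xz inv0) auto
  moreover have "\<forall>\<^sub>F z in at_infinity. 1 / z / (X' z / z) = 1 / X' z"
    using nz by eventually_elim simp
  ultimately have "((\<lambda>z. 1 / X' z) \<longlongrightarrow> 0 / 1) at_infinity"
    by (rule Lim_transform_eventually)
  then have z': "((\<lambda>z. 1 / X' z) \<longlongrightarrow> 0) at_infinity"
    by simp
  have root: "\<forall>\<^sub>F z in at_infinity. poly (chart g (1 / X' z)) (Y' z / X' z) = 0"
    using nz Xnz
  proof eventually_elim
    case (elim z)
    then have "(X' z, Y' z) \<in> curve_points g"
      using p(1) by (simp add: X'_def Y'_def)
    with elim show ?case
      by (simp add: chart_root_in_curve_points)
  qed
  \<comment> \<open>The chosen points tend to (1:mf:0). There the equation of g has the value (mf -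
    mg)^(deg g), which must therefore be 0.\<close>
  have "((\<lambda>z. poly (chart g (1 / X' z)) (Y' z / X' z)) \<longlongrightarrow> (mf - mg) ^ total_degree g
      + 0 * (poly (dehom (total_degree g - 1) g) mf + 0 * poly (chart_tail g 0) mf)) at_infinity"
    unfolding poly_chart_perfect_at[OF g(1)]
    by (intro tendsto_intros tendsto_poly_chart_tail u' z')
  moreover have "((\<lambda>z. poly (chart g (1 / X' z)) (Y' z / X' z)) \<longlongrightarrow> 0) at_infinity"
    using root by (simp add: tendsto_eventually)
  ultimately have "(mf - mg) ^ total_degree g = 0"
    using tendsto_unique[OF trivial_limit_at_infinity] by fastforce
  then have "mf = mg"
    by simp
  then have gg: "germ g mg (\<lambda>z. Y' z / X' z) (\<lambda>z. 1 / X' z) at_infinity"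
    unfolding germ_def using g(1) u' z' root Xnz by (auto elim: eventually_mono)
  \<comment> \<open>With u' = Y'/X' this is Y - z u', the difference of the slopes Y/z and u'
    divided by 1/z.\<close>
  have "((\<lambda>z. Y' z / X' z * (X' z - z) - (Y' z - Y z)) \<longlongrightarrow> mf * 0 - 0) at_infinity"
    by (intro tendsto_intros u' X Y)
  moreover have "\<forall>\<^sub>F z in at_infinity. Y' z / X' z * (X' z - z) - (Y' z - Y z)
      = (Y z / z - Y' z / X' z) / (1 / z)"
    using nz Xnz by eventually_elim (simp add: field_simps)
  ultimately have uu: "((\<lambda>z. (Y z / z - Y' z / X' z) / (1 / z)) \<longlongrightarrow> 0) at_infinity"
    using Lim_transform_eventually by fastforce
  have "((\<lambda>z. (X' z - z) / (X' z / z)) \<longlongrightarrow> 0 / 1) at_infinity"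
    by (intro tendsto_intros X Xz) auto
  moreover have "\<forall>\<^sub>F z in at_infinity. (X' z - z) / (X' z / z) = (1 / z - 1 / X' z) / (1 / z)\<^sup>2"
    using nz Xnz by eventually_elim (simp add: field_simps power2_eq_square)
  ultimately have zz: "((\<lambda>z. (1 / z - 1 / X' z) / (1 / z)\<^sup>2) \<longlongrightarrow> 0) at_infinity"
    using Lim_transform_eventually by fastforce
  from close_germs_imp_eq_dehom[OF gf gg trivial_limit_at_infinity uu zz]
  show "total_degree g = total_degree f"
    "dehom (total_degree f) g = dehom (total_degree f) f"
    "dehom (total_degree f - 1) g = dehom (total_degree f - 1) f"
    by auto
qed

text \<open>Above each large z the chart of g has a root r near Y/z. The point (z, z r) has the same
  first coordinate as the leaf point (z, Y), so their distance is |z| |Y/z - r|, at most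
  b(z).\<close>

lemma eq_dehom_imp_approaches:
  assumes f: "perfect_at f m" "infinity_points f = {proj_point 1 m 0}"
    and g: "perfect_at g mg" and deg: "total_degree g = total_degree f"
    and eq: "dehom (total_degree f) g = dehom (total_degree f) f"
      "dehom (total_degree f - 1) g = dehom (total_degree f - 1) f"
  shows "approaches g f"
proof -
  obtain B N \<psi> M where B: "branch_data f m B N \<psi> M"
    using exists_infinity_branch[OF f(1)] f(2) by blast
  define Y where "Y = leaf_fun N \<psi> 1"
  have gf: "germ f m (\<lambda>z. Y z / z) (\<lambda>z. 1 / z) at_infinity"
    unfolding Y_def by (rule branch_data_germ[OF f B]) simp
  \<comment> \<open>Evaluating (y - m)^d = (y - mg)^d at y = m gives mg = m.\<close>
  have "poly ([:-m, 1:] ^ total_degree f) m = poly ([:-mg, 1:] ^ total_degree f) m"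
    using f(1) g deg eq(1) by (simp only: perfect_at_def)
  then have "mg = m"
    using f(1) by (auto simp: perfect_at_def poly_power zero_power)
  with g have "perfect_at g m"
    by simp
  from exists_close_root_of_eq_dehom[OF gf this deg eq(2)]
  obtain b where b: "(b \<longlongrightarrow> 0) at_infinity"
    "\<forall>\<^sub>F z in at_infinity. \<exists>r. poly (chart g (1 / z)) r = 0 \<and> norm (Y z / z - r) \<le> norm (1 / z) * b z" .
  have "\<forall>\<^sub>F z in at_infinity. norm (infdist (z, Y z) (curve_points g)) \<le> b z"
    using b(2) eventually_not_equal_at_infinity[of 0]
  proof eventually_elim
    case (elim z)
    then obtain r where r: "poly (chart g (1 / z)) r = 0" "norm (Y z / z - r) \<le> norm (1 / z) * b z"
      by blast
    then have "(z, z * r) \<in> curve_points g"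
      using elim(2) by (simp add: chart_root_in_curve_points)
    then have "infdist (z, Y z) (curve_points g) \<le> dist (z, Y z) (z, z * r)"
      by (rule infdist_le)
    also have "\<dots> = norm (z * (Y z / z - r))"
      using elim(2) by (simp add: dist_Pair_Pair dist_norm right_diff_distrib)
    also have "\<dots> = norm z * norm (Y z / z - r)"
      by (rule norm_mult)
    also have "\<dots> \<le> norm z * (norm (1 / z) * b z)"
      using r(2) by (rule mult_left_mono) simp
    also have "\<dots> = b z"
      using elim(2) by (simp add: norm_divide)
    finally show ?case
      by (simp add: infdist_nonneg)
  qed
  then have "((\<lambda>z. infdist (z, Y z) (curve_points g)) \<longlongrightarrow> 0) at_infinity"
    using b(1) by (rule Lim_null_comparison)
  then have "approaches_at g f B"
    unfolding approaches_at_def Y_def using B power_one by blast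
  then show ?thesis
    unfolding approaches_def infinity_branch_def using B by blast
qed

theorem corollary5p3:
  fixes f g :: "real poly poly"
  assumes "irreducible f" and "irreducible g"
    and "regular_perfect_curve (complexify f)"
    and "regular_perfect_curve (complexify g)"
    and "proj_point 0 1 0 \<notin> infinity_points (complexify f)"
    and "proj_point 0 1 0 \<notin> infinity_points (complexify g)"
    and "coeff (coeff f (total_degree f)) 0 = 1"
    and "coeff (coeff g (total_degree g)) 0 = 1"
  shows "approach_each_other (complexify f) (complexify g) \<longleftrightarrow>
    (\<exists>d. total_degree f = d \<and> total_degree g = d \<and>
      hom_part d f = hom_part d g \<and> hom_part (d - 1) f = hom_part (d - 1) g)"
proof -
  obtain mf where f: "perfect_at (complexify f) mf"
      "infinity_points (complexify f) = {proj_point 1 mf 0}"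
    by (rule regular_perfect_curve_perfect_at[OF assms(3)]) (use assms(7) in auto)
  obtain mg where g: "perfect_at (complexify g) mg"
      "infinity_points (complexify g) = {proj_point 1 mg 0}"
    by (rule regular_perfect_curve_perfect_at[OF assms(4)]) (use assms(8) in auto)
  \<comment> \<open>Equality of homogeneous parts descends to the real polynomials because the
    embedding of coefficients is injective.\<close>
  have dehom_iff: "dehom k (complexify f) = dehom k (complexify g) \<longleftrightarrow> hom_part k f = hom_part k g" for k
    unfolding hom_part_eq_iff[symmetric] by (rule hom_part_complexify_eq_iff)
  show ?thesis
  proof
    assume "approach_each_other (complexify f) (complexify g)"
    then have "approaches (complexify g) (complexify f)"
      by (simp add: approach_each_other_def)
    from approaches_imp_eq_dehom[OF f g this]
    show "\<exists>d. total_degree f = d \<and> total_degree g = d \<and>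
      hom_part d f = hom_part d g \<and> hom_part (d - 1) f = hom_part (d - 1) g"
      by (auto simp flip: dehom_iff)
  next
    assume "\<exists>d. total_degree f = d \<and> total_degree g = d \<and>
      hom_part d f = hom_part d g \<and> hom_part (d - 1) f = hom_part (d - 1) g"
    then have "total_degree g = total_degree f"
      "dehom (total_degree f) (complexify f) = dehom (total_degree f) (complexify g)"
      "dehom (total_degree f - 1) (complexify f) = dehom (total_degree f - 1) (complexify g)"
      by (auto simp: dehom_iff)
    then show "approach_each_other (complexify f) (complexify g)"
      unfolding approach_each_other_def
      using eq_dehom_imp_approaches[OF f g(1)] eq_dehom_imp_approaches[OF g f(1)] by simp
  qed
qed

end
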